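(* Let $A$ be a type in a context extended by a fresh bridge variable $\mathbf{x}$ and a fresh path variable $y$; let $M_0:A[0/y]$ and $M_1:A[1/y]$ (in the context with $\mathbf{x}$), and let $P_0:\mathsf{Path}_{y.A}(M_0,M_1)[\mathbf{0}/\mathbf{x}]$ and $P_1:\mathsf{Path}_{y.A}(M_0,M_1)[\mathbf{1}/\mathbf{x}]$. Then there is an equivalence \[ \mathsf{Bridge}_{\mathbf{x}.\mathsf{Path}_{y.A}(M_0,M_1)}(P_0,P_1)\simeq \mathsf{Path}_{y.\mathsf{Bridge}_{\mathbf{x}.A}(P_0@y,\,P_1@y)}(\lambda^{\mathbf{x}}M_0,\lambda^{\mathbf{x}}M_1). \]
   Context: We work in parametric cubical type theory: Martin-Löf type theory with $\Sigma$-, $\Pi$-types and a universe of Kan types, extended by path dimensions (structural; variables $x,y,\dots$, constants $0,1$) and bridge dimensions (substructural: weakening and exchange but no contraction; variables $\mathbf{x},\dots$, constants $\mathbf{0},\mathbf{1}$). For $A$ depending on a path variable $y$ and $M_\varepsilon:A[\varepsilon/y]$, $\mathsf{Path}_{y.A}(M_0,M_1)$ has elements $\langle y\rangle P$ with $P[\varepsilon/y]=M_\varepsilon$, application $Q@r$, $\beta$, $\eta$ and endpoint rules; all types are Kan, so paths behave like identity types of homotopy type theory and equivalences $\simeq$ are defined as there. For $A$ depending on a fresh bridge variable $\mathbf{x}$ and $M_{\boldsymbol\varepsilon}:A[\boldsymbol\varepsilon/\mathbf{x}]$, $\mathsf{Bridge}_{\mathbf{x}.A}(M_{\mathbf{0}},M_{\mathbf{1}})$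 has elements $\lambda^{\mathbf{x}}P$ with $P[\boldsymbol\varepsilon/\mathbf{x}]=M_{\boldsymbol\varepsilon}$, application $Q\,\mathbf{r}$ (only for $\mathbf{r}$ not occurring in $Q$), $\beta$, endpoint rules $Q\,\boldsymbol\varepsilon=M_{\boldsymbol\varepsilon}$, and $\eta$. *)

theory Defs
  imports Main
begin

section \<open>Raw syntax\<close>

text \<open>
  Raw expressions are in de Bruijn form. Term variables, path variables and bridge variables share
  one index space, and dimension terms are raw expressions too; the judgments below separate the
  sorts. The first argument of \<open>PathT\<close> (of \<open>BridgeT\<close>) binds a path (bridge) variable.
  \<open>Com A r s M Ns\<close> is the composition of \<open>M\<close> from \<open>r\<close> to \<open>s\<close> in the line of types \<open>A\<close>, where \<open>A\<close>
  and each tube \<open>N\<close> with \<open>(\<xi>, N) \<in> set Ns\<close> bind a path variable, and \<open>\<xi>\<close> is the face on which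
  \<open>N\<close> is given. Coercion is the case \<open>Ns = []\<close>, homogeneous composition the case of constant \<open>A\<close>.
  \<open>Ty\<close> is not a type: \<open>A : Ty\<close> is the judgment that \<open>A\<close> is a (Kan) type; \<open>Uni\<close> is the universe.
\<close>

datatype 'a eqn = PathEq 'a 'a | BridgeEq 'a 'a

datatype tm =
    Var nat
  | PZero | POne | BZero | BOne
  | Ty | Uni
  | Pi tm tm | Lam tm | App tm tm
  | Sig tm tm | Pair tm tm | Fst tm | Snd tm
  | PathT tm tm tm | PLam tm | PApp tm tm
  | BridgeT tm tm tm | BLam tm | BApp tm tm
  | Com tm tm tm tm "(tm eqn \<times> tm) list"

definition upr :: "(nat \<Rightarrow> nat) \<Rightarrow> nat \<Rightarrow> nat" where
  "upr f = case_nat 0 (\<lambda>i. Suc (f i))"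

primrec ren :: "(nat \<Rightarrow> nat) \<Rightarrow> tm \<Rightarrow> tm" where
  "ren f (Var i) = Var (f i)"
| "ren f PZero = PZero"
| "ren f POne = POne"
| "ren f BZero = BZero"
| "ren f BOne = BOne"
| "ren f Ty = Ty"
| "ren f Uni = Uni"
| "ren f (Pi A B) = Pi (ren f A) (ren (upr f) B)"
| "ren f (Lam M) = Lam (ren (upr f) M)"
| "ren f (App M N) = App (ren f M) (ren f N)"
| "ren f (Sig A B) = Sig (ren f A) (ren (upr f) B)"
| "ren f (Pair M N) = Pair (ren f M) (ren f N)"
| "ren f (Fst M) = Fst (ren f M)"
| "ren f (Snd M) = Snd (ren f M)"
| "ren f (PathT A M N) = PathT (ren (upr f) A) (ren f M) (ren f N)"
| "ren f (PLam M) = PLam (ren (upr f) M)"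
| "ren f (PApp M r) = PApp (ren f M) (ren f r)"
| "ren f (BridgeT A M N) = BridgeT (ren (upr f) A) (ren f M) (ren f N)"
| "ren f (BLam M) = BLam (ren (upr f) M)"
| "ren f (BApp M r) = BApp (ren f M) (ren f r)"
| "ren f (Com A r s M Ns) = Com (ren (upr f) A) (ren f r) (ren f s) (ren f M)
     (map (map_prod (map_eqn (ren f)) (ren (upr f))) Ns)"

definition wkn :: "tm \<Rightarrow> nat \<Rightarrow> tm" (infixl "\<up>" 90) where
  "M \<up> n = ren (\<lambda>i. n + i) M"

definition wkn_eqn :: "tm eqn \<Rightarrow> nat \<Rightarrow> tm eqn" (infixl "\<Up>" 90) where
  "\<xi> \<Up> n = map_eqn (\<lambda>r. r \<up> n) \<xi>"

text \<open>Exchange of the two most recent variables: \<open>A\<close> over \<open>\<Gamma>, x, y\<close> becomes \<open>swap01 A\<close> over \<open>\<Gamma>, y, x\<close>.\<close>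

definition swap01 :: "tm \<Rightarrow> tm" where
  "swap01 = ren (id(0 := 1, 1 := 0))"

definition scons :: "tm \<Rightarrow> (nat \<Rightarrow> tm) \<Rightarrow> nat \<Rightarrow> tm" (infixr "\<cdot>" 70) where
  "M \<cdot> \<sigma> = case_nat M \<sigma>"

definition up :: "(nat \<Rightarrow> tm) \<Rightarrow> nat \<Rightarrow> tm" where
  "up \<sigma> = Var 0 \<cdot> (\<lambda>i. \<sigma> i \<up> 1)"

primrec subst :: "(nat \<Rightarrow> tm) \<Rightarrow> tm \<Rightarrow> tm" where
  "subst \<sigma> (Var i) = \<sigma> i"
| "subst \<sigma> PZero = PZero"
| "subst \<sigma> POne = POne"
| "subst \<sigma> BZero = BZero"
| "subst \<sigma> BOne = BOne"
| "subst \<sigma> Ty = Ty"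
| "subst \<sigma> Uni = Uni"
| "subst \<sigma> (Pi A B) = Pi (subst \<sigma> A) (subst (up \<sigma>) B)"
| "subst \<sigma> (Lam M) = Lam (subst (up \<sigma>) M)"
| "subst \<sigma> (App M N) = App (subst \<sigma> M) (subst \<sigma> N)"
| "subst \<sigma> (Sig A B) = Sig (subst \<sigma> A) (subst (up \<sigma>) B)"
| "subst \<sigma> (Pair M N) = Pair (subst \<sigma> M) (subst \<sigma> N)"
| "subst \<sigma> (Fst M) = Fst (subst \<sigma> M)"
| "subst \<sigma> (Snd M) = Snd (subst \<sigma> M)"
| "subst \<sigma> (PathT A M N) = PathT (subst (up \<sigma>) A) (subst \<sigma> M) (subst \<sigma> N)"
| "subst \<sigma> (PLam M) = PLam (subst (up \<sigma>) M)"
| "subst \<sigma> (PApp M r) = PApp (subst \<sigma> M) (subst \<sigma> r)"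
| "subst \<sigma> (BridgeT A M N) = BridgeT (subst (up \<sigma>) A) (subst \<sigma> M) (subst \<sigma> N)"
| "subst \<sigma> (BLam M) = BLam (subst (up \<sigma>) M)"
| "subst \<sigma> (BApp M r) = BApp (subst \<sigma> M) (subst \<sigma> r)"
| "subst \<sigma> (Com A r s M Ns) = Com (subst (up \<sigma>) A) (subst \<sigma> r) (subst \<sigma> s) (subst \<sigma> M)
     (map (map_prod (map_eqn (subst \<sigma>)) (subst (up \<sigma>))) Ns)"

definition inst :: "tm \<Rightarrow> tm \<Rightarrow> tm" ("_\<langle>_\<rangle>" [1000, 0] 1000) where
  "M\<langle>N\<rangle> = subst (N \<cdot> Var) M"


section \<open>Contexts\<close>

text \<open>
  The most recent entry is the head of the list. Every entry occupies one de Bruijn index: an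
  \<open>Eqn\<close> entry assumes an equation between dimensions, and a \<open>Blank\<close> entry is a removed entry that
  is kept only so that indices do not change; no rule lets the variable of an \<open>Eqn\<close> or \<open>Blank\<close>
  entry occur in an expression.
\<close>

datatype entry = Hyp tm | PVar | BVar | Eqn "tm eqn" | Blank

type_synonym ctx = "entry list"

abbreviation ext :: "ctx \<Rightarrow> entry \<Rightarrow> ctx" (infixl "\<triangleright>" 65) where
  "\<Gamma> \<triangleright> e \<equiv> e # \<Gamma>"

text \<open>
  \<open>cut \<Gamma> r\<close> is the context of the expressions that are apart from the bridge term \<open>r\<close>. For a
  bridge variable it removes that variable together with every later term variable, since the
  value of a later term variable may depend on it, and every later equation in which it occurs.
  Later path and bridge variables stay, which makes bridge variables subject to exchange.
  For a constant nothing is removed.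
\<close>

primrec cut_var :: "nat \<Rightarrow> entry \<Rightarrow> entry" where
  "cut_var i (Hyp A) = Blank"
| "cut_var i PVar = PVar"
| "cut_var i BVar = BVar"
| "cut_var i (Eqn \<xi>) = (if Var i \<in> set_eqn \<xi> then Blank else Eqn \<xi>)"
| "cut_var i Blank = Blank"

fun cut_at :: "ctx \<Rightarrow> nat \<Rightarrow> ctx" where
  "cut_at [] i = []"
| "cut_at (e # \<Gamma>) 0 = Blank # \<Gamma>"
| "cut_at (e # \<Gamma>) (Suc i) = cut_var i e # cut_at \<Gamma> i"

definition cut :: "ctx \<Rightarrow> tm \<Rightarrow> ctx" where
  "cut \<Gamma> r = (case r of Var i \<Rightarrow> cut_at \<Gamma> i | _ \<Rightarrow> \<Gamma>)"

definition pdim :: "ctx \<Rightarrow> tm \<Rightarrow> bool" where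
  "pdim \<Gamma> r \<longleftrightarrow> r = PZero \<or> r = POne \<or> (\<exists>i. r = Var i \<and> i < length \<Gamma> \<and> \<Gamma> ! i = PVar)"

definition bdim :: "ctx \<Rightarrow> tm \<Rightarrow> bool" where
  "bdim \<Gamma> r \<longleftrightarrow> r = BZero \<or> r = BOne \<or> (\<exists>i. r = Var i \<and> i < length \<Gamma> \<and> \<Gamma> ! i = BVar)"

text \<open>
  Faces equate two path terms, or a bridge term with a bridge constant; a face equating two bridge
  variables would be a diagonal, which is not available without contraction.
\<close>

primrec face :: "ctx \<Rightarrow> tm eqn \<Rightarrow> bool" where
  "face \<Gamma> (PathEq r s) \<longleftrightarrow> pdim \<Gamma> r \<and> pdim \<Gamma> s"
| "face \<Gamma> (BridgeEq r s) \<longleftrightarrow> bdim \<Gamma> r \<and> s \<in> {BZero, BOne}"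

inductive holds :: "ctx \<Rightarrow> tm eqn \<Rightarrow> bool" where
  holds_hyp: "i < length \<Gamma> \<Longrightarrow> \<Gamma> ! i = Eqn \<xi> \<Longrightarrow> holds \<Gamma> (\<xi> \<Up> Suc i)"
| path_refl: "pdim \<Gamma> r \<Longrightarrow> holds \<Gamma> (PathEq r r)"
| path_sym: "holds \<Gamma> (PathEq r s) \<Longrightarrow> holds \<Gamma> (PathEq s r)"
| path_trans: "holds \<Gamma> (PathEq r s) \<Longrightarrow> holds \<Gamma> (PathEq s t) \<Longrightarrow> holds \<Gamma> (PathEq r t)"
| bridge_refl: "bdim \<Gamma> r \<Longrightarrow> holds \<Gamma> (BridgeEq r r)"
| bridge_sym: "holds \<Gamma> (BridgeEq r s) \<Longrightarrow> holds \<Gamma> (BridgeEq s r)"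
| bridge_trans: "holds \<Gamma> (BridgeEq r s) \<Longrightarrow> holds \<Gamma> (BridgeEq s t) \<Longrightarrow> holds \<Gamma> (BridgeEq r t)"

definition absurd :: "ctx \<Rightarrow> bool" where
  "absurd \<Gamma> \<longleftrightarrow> holds \<Gamma> (PathEq PZero POne) \<or> holds \<Gamma> (BridgeEq BZero BOne)"

primrec face_eq :: "ctx \<Rightarrow> tm eqn \<Rightarrow> tm eqn \<Rightarrow> bool" where
  "face_eq \<Gamma> (PathEq r s) \<xi> \<longleftrightarrow>
     (\<exists>r' s'. \<xi> = PathEq r' s' \<and> holds \<Gamma> (PathEq r r') \<and> holds \<Gamma> (PathEq s s'))"
| "face_eq \<Gamma> (BridgeEq r s) \<xi> \<longleftrightarrow>
     (\<exists>r' s'. \<xi> = BridgeEq r' s' \<and> holds \<Gamma> (BridgeEq r r') \<and> holds \<Gamma> (BridgeEq s s'))"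


section \<open>Judgments\<close>

text \<open>
  Well-formed contexts, typing, judgmental equality, and substitutions. With \<open>K \<in> {Ty, Uni}\<close>, the
  formation rules simultaneously define the types and the elements of the universe. The structural
  rules are \<open>t_sub\<close> and \<open>e_sub\<close>. Bridge variables are substructural because of \<open>s_bridge\<close>: the
  rest of a substitution must be apart from the term substituted for a bridge variable.
\<close>

inductive
  ok :: "ctx \<Rightarrow> bool" and
  typing :: "ctx \<Rightarrow> tm \<Rightarrow> tm \<Rightarrow> bool" ("_ \<turnstile> _ \<Colon> _" [51, 51, 51] 50) and
  equal :: "ctx \<Rightarrow> tm \<Rightarrow> tm \<Rightarrow> tm \<Rightarrow> bool" ("_ \<turnstile> _ \<approx> _ \<Colon> _" [51, 51, 51, 51] 50) and
  substn :: "ctx \<Rightarrow> (nat \<Rightarrow> tm) \<Rightarrow> ctx \<Rightarrow> bool" ("_ \<tturnstile> _ \<Colon> _" [51, 51, 51] 50)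
where
  ok_nil: "ok []"
| ok_hyp: "ok \<Gamma> \<Longrightarrow> \<Gamma> \<turnstile> A \<Colon> Ty \<Longrightarrow> ok (\<Gamma> \<triangleright> Hyp A)"
| ok_path: "ok \<Gamma> \<Longrightarrow> ok (\<Gamma> \<triangleright> PVar)"
| ok_bridge: "ok \<Gamma> \<Longrightarrow> ok (\<Gamma> \<triangleright> BVar)"
| ok_eqn: "ok \<Gamma> \<Longrightarrow> face \<Gamma> \<xi> \<Longrightarrow> ok (\<Gamma> \<triangleright> Eqn \<xi>)"
| ok_blank: "ok \<Gamma> \<Longrightarrow> ok (\<Gamma> \<triangleright> Blank)"

| s_nil: "ok \<Delta> \<Longrightarrow> \<Delta> \<tturnstile> \<sigma> \<Colon> []"
| s_hyp: "\<Delta> \<tturnstile> \<sigma> \<Colon> \<Gamma> \<Longrightarrow> \<Gamma> \<turnstile> A \<Colon> Ty \<Longrightarrow> \<Delta> \<turnstile> M \<Colon> subst \<sigma> A \<Longrightarrow> \<Delta> \<tturnstile> M \<cdot> \<sigma> \<Colon> \<Gamma> \<triangleright> Hyp A"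
| s_path: "\<Delta> \<tturnstile> \<sigma> \<Colon> \<Gamma> \<Longrightarrow> pdim \<Delta> r \<Longrightarrow> \<Delta> \<tturnstile> r \<cdot> \<sigma> \<Colon> \<Gamma> \<triangleright> PVar"
| s_bridge: "ok \<Delta> \<Longrightarrow> cut \<Delta> r \<tturnstile> \<sigma> \<Colon> \<Gamma> \<Longrightarrow> bdim \<Delta> r \<Longrightarrow> \<Delta> \<tturnstile> r \<cdot> \<sigma> \<Colon> \<Gamma> \<triangleright> BVar"
| s_eqn: "\<Delta> \<tturnstile> \<sigma> \<Colon> \<Gamma> \<Longrightarrow> face \<Gamma> \<xi> \<Longrightarrow> holds \<Delta> (map_eqn (subst \<sigma>) \<xi>) \<Longrightarrow>
    \<Delta> \<tturnstile> M \<cdot> \<sigma> \<Colon> \<Gamma> \<triangleright> Eqn \<xi>"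
| s_blank: "\<Delta> \<tturnstile> \<sigma> \<Colon> \<Gamma> \<Longrightarrow> \<Delta> \<tturnstile> M \<cdot> \<sigma> \<Colon> \<Gamma> \<triangleright> Blank"

| t_var: "ok \<Gamma> \<Longrightarrow> i < length \<Gamma> \<Longrightarrow> \<Gamma> ! i = Hyp A \<Longrightarrow> \<Gamma> \<turnstile> Var i \<Colon> A \<up> Suc i"
| t_sub: "\<Gamma> \<turnstile> M \<Colon> A \<Longrightarrow> \<Delta> \<tturnstile> \<sigma> \<Colon> \<Gamma> \<Longrightarrow> \<Delta> \<turnstile> subst \<sigma> M \<Colon> subst \<sigma> A"
| t_conv: "\<Gamma> \<turnstile> M \<Colon> A \<Longrightarrow> \<Gamma> \<turnstile> A \<approx> B \<Colon> Ty \<Longrightarrow> \<Gamma> \<turnstile> M \<Colon> B"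
| t_uni: "ok \<Gamma> \<Longrightarrow> \<Gamma> \<turnstile> Uni \<Colon> Ty"
| t_el: "\<Gamma> \<turnstile> A \<Colon> Uni \<Longrightarrow> \<Gamma> \<turnstile> A \<Colon> Ty"

| t_Pi: "K \<in> {Ty, Uni} \<Longrightarrow> \<Gamma> \<turnstile> A \<Colon> K \<Longrightarrow> \<Gamma> \<triangleright> Hyp A \<turnstile> B \<Colon> K \<Longrightarrow> \<Gamma> \<turnstile> Pi A B \<Colon> K"
| t_Lam: "\<Gamma> \<triangleright> Hyp A \<turnstile> M \<Colon> B \<Longrightarrow> \<Gamma> \<turnstile> Lam M \<Colon> Pi A B"
| t_App: "\<Gamma> \<turnstile> M \<Colon> Pi A B \<Longrightarrow> \<Gamma> \<turnstile> N \<Colon> A \<Longrightarrow> \<Gamma> \<turnstile> App M N \<Colon> B\<langle>N\<rangle>"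

| t_Sig: "K \<in> {Ty, Uni} \<Longrightarrow> \<Gamma> \<turnstile> A \<Colon> K \<Longrightarrow> \<Gamma> \<triangleright> Hyp A \<turnstile> B \<Colon> K \<Longrightarrow> \<Gamma> \<turnstile> Sig A B \<Colon> K"
| t_Pair: "\<Gamma> \<triangleright> Hyp A \<turnstile> B \<Colon> Ty \<Longrightarrow> \<Gamma> \<turnstile> M \<Colon> A \<Longrightarrow> \<Gamma> \<turnstile> N \<Colon> B\<langle>M\<rangle> \<Longrightarrow> \<Gamma> \<turnstile> Pair M N \<Colon> Sig A B"
| t_Fst: "\<Gamma> \<turnstile> M \<Colon> Sig A B \<Longrightarrow> \<Gamma> \<turnstile> Fst M \<Colon> A"
| t_Snd: "\<Gamma> \<turnstile> M \<Colon> Sig A B \<Longrightarrow> \<Gamma> \<turnstile> Snd M \<Colon> B\<langle>Fst M\<rangle>"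

| t_Path: "K \<in> {Ty, Uni} \<Longrightarrow> \<Gamma> \<triangleright> PVar \<turnstile> A \<Colon> K \<Longrightarrow> \<Gamma> \<turnstile> M \<Colon> A\<langle>PZero\<rangle> \<Longrightarrow> \<Gamma> \<turnstile> N \<Colon> A\<langle>POne\<rangle> \<Longrightarrow>
    \<Gamma> \<turnstile> PathT A M N \<Colon> K"
| t_PLam: "\<Gamma> \<triangleright> PVar \<turnstile> P \<Colon> A \<Longrightarrow>
    \<Gamma> \<turnstile> P\<langle>PZero\<rangle> \<approx> M \<Colon> A\<langle>PZero\<rangle> \<Longrightarrow> \<Gamma> \<turnstile> P\<langle>POne\<rangle> \<approx> N \<Colon> A\<langle>POne\<rangle> \<Longrightarrow> \<Gamma> \<turnstile> PLam P \<Colon> PathT A M N"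
| t_PApp: "\<Gamma> \<turnstile> Q \<Colon> PathT A M N \<Longrightarrow> pdim \<Gamma> r \<Longrightarrow> \<Gamma> \<turnstile> PApp Q r \<Colon> A\<langle>r\<rangle>"

| t_Bridge: "K \<in> {Ty, Uni} \<Longrightarrow> \<Gamma> \<triangleright> BVar \<turnstile> A \<Colon> K \<Longrightarrow> \<Gamma> \<turnstile> M \<Colon> A\<langle>BZero\<rangle> \<Longrightarrow> \<Gamma> \<turnstile> N \<Colon> A\<langle>BOne\<rangle> \<Longrightarrow>
    \<Gamma> \<turnstile> BridgeT A M N \<Colon> K"
| t_BLam: "\<Gamma> \<triangleright> BVar \<turnstile> P \<Colon> A \<Longrightarrow>
    \<Gamma> \<turnstile> P\<langle>BZero\<rangle> \<approx> M \<Colon> A\<langle>BZero\<rangle> \<Longrightarrow> \<Gamma> \<turnstile> P\<langle>BOne\<rangle> \<approx> N \<Colon> A\<langle>BOne\<rangle> \<Longrightarrow> \<Gamma> \<turnstile> BLam P \<Colon> BridgeT A M N"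
| t_BApp: "ok \<Gamma> \<Longrightarrow> bdim \<Gamma> r \<Longrightarrow> cut \<Gamma> r \<turnstile> Q \<Colon> BridgeT A M N \<Longrightarrow> \<Gamma> \<turnstile> BApp Q r \<Colon> A\<langle>r\<rangle>"

| t_Com: "\<Gamma> \<triangleright> PVar \<turnstile> A \<Colon> Ty \<Longrightarrow> pdim \<Gamma> r \<Longrightarrow> pdim \<Gamma> s \<Longrightarrow> \<Gamma> \<turnstile> M \<Colon> A\<langle>r\<rangle> \<Longrightarrow>
    (\<And>\<xi> N. (\<xi>, N) \<in> set Ns \<Longrightarrow> face \<Gamma> \<xi>) \<Longrightarrow>
    (\<And>\<xi> N. (\<xi>, N) \<in> set Ns \<Longrightarrow> \<Gamma> \<triangleright> PVar \<triangleright> Eqn (\<xi> \<Up> 1) \<turnstile> N \<up> 1 \<Colon> A \<up> 1) \<Longrightarrow>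
    (\<And>\<xi> N. (\<xi>, N) \<in> set Ns \<Longrightarrow> \<Gamma> \<triangleright> Eqn \<xi> \<turnstile> N\<langle>r\<rangle> \<up> 1 \<approx> M \<up> 1 \<Colon> A\<langle>r\<rangle> \<up> 1) \<Longrightarrow>
    (\<And>\<xi> N \<xi>' N'. (\<xi>, N) \<in> set Ns \<Longrightarrow> (\<xi>', N') \<in> set Ns \<Longrightarrow>
      \<Gamma> \<triangleright> PVar \<triangleright> Eqn (\<xi> \<Up> 1) \<triangleright> Eqn (\<xi>' \<Up> 2) \<turnstile> N \<up> 2 \<approx> N' \<up> 2 \<Colon> A \<up> 2) \<Longrightarrow>
    \<Gamma> \<turnstile> Com A r s M Ns \<Colon> A\<langle>s\<rangle>"

| e_refl: "\<Gamma> \<turnstile> M \<Colon> A \<Longrightarrow> \<Gamma> \<turnstile> M \<approx> M \<Colon> A"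
| e_sym: "\<Gamma> \<turnstile> M \<approx> N \<Colon> A \<Longrightarrow> \<Gamma> \<turnstile> N \<approx> M \<Colon> A"
| e_trans: "\<Gamma> \<turnstile> M \<approx> N \<Colon> A \<Longrightarrow> \<Gamma> \<turnstile> N \<approx> P \<Colon> A \<Longrightarrow> \<Gamma> \<turnstile> M \<approx> P \<Colon> A"
| e_sub: "\<Gamma> \<turnstile> M \<approx> N \<Colon> A \<Longrightarrow> \<Delta> \<tturnstile> \<sigma> \<Colon> \<Gamma> \<Longrightarrow> \<Delta> \<turnstile> subst \<sigma> M \<approx> subst \<sigma> N \<Colon> subst \<sigma> A"
| e_conv: "\<Gamma> \<turnstile> M \<approx> N \<Colon> A \<Longrightarrow> \<Gamma> \<turnstile> A \<approx> B \<Colon> Ty \<Longrightarrow> \<Gamma> \<turnstile> M \<approx> N \<Colon> B"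
| e_el: "\<Gamma> \<turnstile> A \<approx> B \<Colon> Uni \<Longrightarrow> \<Gamma> \<turnstile> A \<approx> B \<Colon> Ty"
| e_absurd: "absurd \<Gamma> \<Longrightarrow> \<Gamma> \<turnstile> M \<Colon> A \<Longrightarrow> \<Gamma> \<turnstile> N \<Colon> A \<Longrightarrow> \<Gamma> \<turnstile> M \<approx> N \<Colon> A"

| e_Pi: "K \<in> {Ty, Uni} \<Longrightarrow> \<Gamma> \<turnstile> A \<Colon> K \<Longrightarrow> \<Gamma> \<turnstile> A \<approx> A' \<Colon> K \<Longrightarrow> \<Gamma> \<triangleright> Hyp A \<turnstile> B \<approx> B' \<Colon> K \<Longrightarrow>
    \<Gamma> \<turnstile> Pi A B \<approx> Pi A' B' \<Colon> K"
| e_Lam: "\<Gamma> \<triangleright> Hyp A \<turnstile> M \<approx> M' \<Colon> B \<Longrightarrow> \<Gamma> \<turnstile> Lam M \<approx> Lam M' \<Colon> Pi A B"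
| e_App: "\<Gamma> \<turnstile> M \<approx> M' \<Colon> Pi A B \<Longrightarrow> \<Gamma> \<turnstile> N \<approx> N' \<Colon> A \<Longrightarrow> \<Gamma> \<turnstile> App M N \<approx> App M' N' \<Colon> B\<langle>N\<rangle>"
| e_Pi_beta: "\<Gamma> \<triangleright> Hyp A \<turnstile> M \<Colon> B \<Longrightarrow> \<Gamma> \<turnstile> N \<Colon> A \<Longrightarrow> \<Gamma> \<turnstile> App (Lam M) N \<approx> M\<langle>N\<rangle> \<Colon> B\<langle>N\<rangle>"
| e_Pi_eta: "\<Gamma> \<turnstile> M \<Colon> Pi A B \<Longrightarrow> \<Gamma> \<turnstile> M \<approx> Lam (App (M \<up> 1) (Var 0)) \<Colon> Pi A B"

| e_Sig: "K \<in> {Ty, Uni} \<Longrightarrow> \<Gamma> \<turnstile> A \<Colon> K \<Longrightarrow> \<Gamma> \<turnstile> A \<approx> A' \<Colon> K \<Longrightarrow> \<Gamma> \<triangleright> Hyp A \<turnstile> B \<approx> B' \<Colon> K \<Longrightarrow>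
    \<Gamma> \<turnstile> Sig A B \<approx> Sig A' B' \<Colon> K"
| e_Pair: "\<Gamma> \<triangleright> Hyp A \<turnstile> B \<Colon> Ty \<Longrightarrow> \<Gamma> \<turnstile> M \<approx> M' \<Colon> A \<Longrightarrow> \<Gamma> \<turnstile> N \<approx> N' \<Colon> B\<langle>M\<rangle> \<Longrightarrow>
    \<Gamma> \<turnstile> Pair M N \<approx> Pair M' N' \<Colon> Sig A B"
| e_Fst: "\<Gamma> \<turnstile> M \<approx> M' \<Colon> Sig A B \<Longrightarrow> \<Gamma> \<turnstile> Fst M \<approx> Fst M' \<Colon> A"
| e_Snd: "\<Gamma> \<turnstile> M \<approx> M' \<Colon> Sig A B \<Longrightarrow> \<Gamma> \<turnstile> Snd M \<approx> Snd M' \<Colon> B\<langle>Fst M\<rangle>"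
| e_Sig_beta1: "\<Gamma> \<triangleright> Hyp A \<turnstile> B \<Colon> Ty \<Longrightarrow> \<Gamma> \<turnstile> M \<Colon> A \<Longrightarrow> \<Gamma> \<turnstile> N \<Colon> B\<langle>M\<rangle> \<Longrightarrow> \<Gamma> \<turnstile> Fst (Pair M N) \<approx> M \<Colon> A"
| e_Sig_beta2: "\<Gamma> \<triangleright> Hyp A \<turnstile> B \<Colon> Ty \<Longrightarrow> \<Gamma> \<turnstile> M \<Colon> A \<Longrightarrow> \<Gamma> \<turnstile> N \<Colon> B\<langle>M\<rangle> \<Longrightarrow>
    \<Gamma> \<turnstile> Snd (Pair M N) \<approx> N \<Colon> B\<langle>M\<rangle>"
| e_Sig_eta: "\<Gamma> \<turnstile> M \<Colon> Sig A B \<Longrightarrow> \<Gamma> \<turnstile> M \<approx> Pair (Fst M) (Snd M) \<Colon> Sig A B"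

| e_Path: "K \<in> {Ty, Uni} \<Longrightarrow> \<Gamma> \<triangleright> PVar \<turnstile> A \<approx> A' \<Colon> K \<Longrightarrow>
    \<Gamma> \<turnstile> M \<approx> M' \<Colon> A\<langle>PZero\<rangle> \<Longrightarrow> \<Gamma> \<turnstile> N \<approx> N' \<Colon> A\<langle>POne\<rangle> \<Longrightarrow> \<Gamma> \<turnstile> PathT A M N \<approx> PathT A' M' N' \<Colon> K"
| e_PLam: "\<Gamma> \<triangleright> PVar \<turnstile> P \<approx> P' \<Colon> A \<Longrightarrow>
    \<Gamma> \<turnstile> P\<langle>PZero\<rangle> \<approx> M \<Colon> A\<langle>PZero\<rangle> \<Longrightarrow> \<Gamma> \<turnstile> P\<langle>POne\<rangle> \<approx> N \<Colon> A\<langle>POne\<rangle> \<Longrightarrow> \<Gamma> \<turnstile> PLam P \<approx> PLam P' \<Colon> PathT A M N"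
| e_PApp: "\<Gamma> \<turnstile> Q \<approx> Q' \<Colon> PathT A M N \<Longrightarrow> pdim \<Gamma> r \<Longrightarrow> pdim \<Gamma> r' \<Longrightarrow> holds \<Gamma> (PathEq r r') \<Longrightarrow>
    \<Gamma> \<turnstile> PApp Q r \<approx> PApp Q' r' \<Colon> A\<langle>r\<rangle>"
| e_Path_beta: "\<Gamma> \<triangleright> PVar \<turnstile> P \<Colon> A \<Longrightarrow> pdim \<Gamma> r \<Longrightarrow> \<Gamma> \<turnstile> PApp (PLam P) r \<approx> P\<langle>r\<rangle> \<Colon> A\<langle>r\<rangle>"
| e_Path_eta: "\<Gamma> \<turnstile> Q \<Colon> PathT A M N \<Longrightarrow> \<Gamma> \<turnstile> Q \<approx> PLam (PApp (Q \<up> 1) (Var 0)) \<Colon> PathT A M N"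
| e_Path_zero: "\<Gamma> \<turnstile> Q \<Colon> PathT A M N \<Longrightarrow> \<Gamma> \<turnstile> PApp Q PZero \<approx> M \<Colon> A\<langle>PZero\<rangle>"
| e_Path_one: "\<Gamma> \<turnstile> Q \<Colon> PathT A M N \<Longrightarrow> \<Gamma> \<turnstile> PApp Q POne \<approx> N \<Colon> A\<langle>POne\<rangle>"

| e_Bridge: "K \<in> {Ty, Uni} \<Longrightarrow> \<Gamma> \<triangleright> BVar \<turnstile> A \<approx> A' \<Colon> K \<Longrightarrow>
    \<Gamma> \<turnstile> M \<approx> M' \<Colon> A\<langle>BZero\<rangle> \<Longrightarrow> \<Gamma> \<turnstile> N \<approx> N' \<Colon> A\<langle>BOne\<rangle> \<Longrightarrow> \<Gamma> \<turnstile> BridgeT A M N \<approx> BridgeT A' M' N' \<Colon> K"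
| e_BLam: "\<Gamma> \<triangleright> BVar \<turnstile> P \<approx> P' \<Colon> A \<Longrightarrow>
    \<Gamma> \<turnstile> P\<langle>BZero\<rangle> \<approx> M \<Colon> A\<langle>BZero\<rangle> \<Longrightarrow> \<Gamma> \<turnstile> P\<langle>BOne\<rangle> \<approx> N \<Colon> A\<langle>BOne\<rangle> \<Longrightarrow> \<Gamma> \<turnstile> BLam P \<approx> BLam P' \<Colon> BridgeT A M N"
| e_BApp: "ok \<Gamma> \<Longrightarrow> bdim \<Gamma> r \<Longrightarrow> bdim \<Gamma> r' \<Longrightarrow> holds \<Gamma> (BridgeEq r r') \<Longrightarrow>
    cut \<Gamma> r \<turnstile> Q \<approx> Q' \<Colon> BridgeT A M N \<Longrightarrow> cut \<Gamma> r' \<turnstile> Q \<approx> Q' \<Colon> BridgeT A M N \<Longrightarrow>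
    \<Gamma> \<turnstile> BApp Q r \<approx> BApp Q' r' \<Colon> A\<langle>r\<rangle>"
| e_Bridge_beta: "ok \<Gamma> \<Longrightarrow> bdim \<Gamma> r \<Longrightarrow> cut \<Gamma> r \<triangleright> BVar \<turnstile> P \<Colon> A \<Longrightarrow>
    \<Gamma> \<turnstile> BApp (BLam P) r \<approx> P\<langle>r\<rangle> \<Colon> A\<langle>r\<rangle>"
| e_Bridge_eta: "\<Gamma> \<turnstile> Q \<Colon> BridgeT A M N \<Longrightarrow> \<Gamma> \<turnstile> Q \<approx> BLam (BApp (Q \<up> 1) (Var 0)) \<Colon> BridgeT A M N"
| e_Bridge_zero: "\<Gamma> \<turnstile> Q \<Colon> BridgeT A M N \<Longrightarrow> \<Gamma> \<turnstile> BApp Q BZero \<approx> M \<Colon> A\<langle>BZero\<rangle>"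
| e_Bridge_one: "\<Gamma> \<turnstile> Q \<Colon> BridgeT A M N \<Longrightarrow> \<Gamma> \<turnstile> BApp Q BOne \<approx> N \<Colon> A\<langle>BOne\<rangle>"

| e_Com: "\<Gamma> \<turnstile> Com A r s M Ns \<Colon> A\<langle>s\<rangle> \<Longrightarrow> \<Gamma> \<turnstile> Com A' r' s' M' Ns' \<Colon> A'\<langle>s'\<rangle> \<Longrightarrow>
    \<Gamma> \<triangleright> PVar \<turnstile> A \<approx> A' \<Colon> Ty \<Longrightarrow> holds \<Gamma> (PathEq r r') \<Longrightarrow> holds \<Gamma> (PathEq s s') \<Longrightarrow>
    \<Gamma> \<turnstile> M \<approx> M' \<Colon> A\<langle>r\<rangle> \<Longrightarrow>
    length Ns = length Ns' \<Longrightarrow>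
    (\<And>\<xi> N \<xi>' N'. ((\<xi>, N), (\<xi>', N')) \<in> set (zip Ns Ns') \<Longrightarrow> face_eq \<Gamma> \<xi> \<xi>') \<Longrightarrow>
    (\<And>\<xi> N \<xi>' N'. ((\<xi>, N), (\<xi>', N')) \<in> set (zip Ns Ns') \<Longrightarrow>
      \<Gamma> \<triangleright> PVar \<triangleright> Eqn (\<xi> \<Up> 1) \<turnstile> N \<up> 1 \<approx> N' \<up> 1 \<Colon> A \<up> 1) \<Longrightarrow>
    \<Gamma> \<turnstile> Com A r s M Ns \<approx> Com A' r' s' M' Ns' \<Colon> A\<langle>s\<rangle>"
| e_Com_cap: "\<Gamma> \<turnstile> Com A r s M Ns \<Colon> A\<langle>s\<rangle> \<Longrightarrow> holds \<Gamma> (PathEq r s) \<Longrightarrow>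
    \<Gamma> \<turnstile> Com A r s M Ns \<approx> M \<Colon> A\<langle>s\<rangle>"
| e_Com_tube: "\<Gamma> \<turnstile> Com A r s M Ns \<Colon> A\<langle>s\<rangle> \<Longrightarrow> (\<xi>, N) \<in> set Ns \<Longrightarrow> holds \<Gamma> \<xi> \<Longrightarrow>
    \<Gamma> \<turnstile> Com A r s M Ns \<approx> N\<langle>s\<rangle> \<Colon> A\<langle>s\<rangle>"


section \<open>Equivalences\<close>

definition Id :: "tm \<Rightarrow> tm \<Rightarrow> tm \<Rightarrow> tm" where
  "Id A M N = PathT (A \<up> 1) M N"

definition Fn :: "tm \<Rightarrow> tm \<Rightarrow> tm" where
  "Fn A B = Pi A (B \<up> 1)"

text \<open>
  The definition of equivalences fixed in the HoTT book: \<open>f : A \<rightarrow> B\<close> is a half adjoint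
  equivalence if there are \<open>g : B \<rightarrow> A\<close>, \<open>\<eta> : \<Pi>a. g (f a) = a\<close>, \<open>\<epsilon> : \<Pi>b. f (g b) = b\<close> and
  \<open>\<tau> : \<Pi>a. ap f (\<eta> a) = \<epsilon> (f a)\<close>, the last an identification in the type \<open>f (g (f a)) = f a\<close>.
\<close>

definition IsEquiv :: "tm \<Rightarrow> tm \<Rightarrow> tm \<Rightarrow> tm" where
  "IsEquiv A B f =
    Sig (Fn B A)
      (Sig (Pi (A \<up> 1) (Id (A \<up> 2) (App (Var 1) (App (f \<up> 2) (Var 0))) (Var 0)))
        (Sig (Pi (B \<up> 2) (Id (B \<up> 3) (App (f \<up> 3) (App (Var 2) (Var 0))) (Var 0)))
          (Pi (A \<up> 3)
            (Id (Id (B \<up> 4) (App (f \<up> 4) (App (Var 3) (App (f \<up> 4) (Var 0)))) (App (f \<up> 4) (Var 0)))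
              (PLam (App (f \<up> 5) (PApp (App (Var 3) (Var 1)) (Var 0))))
              (App (Var 1) (App (f \<up> 4) (Var 0)))))))"

definition Equiv :: "tm \<Rightarrow> tm \<Rightarrow> tm" where
  "Equiv A B = Sig (Fn A B) (IsEquiv (A \<up> 1) (B \<up> 1) (Var 0))"

end

theory Submission
  imports Defs
begin

text \<open>
  The maps \<open>Q \<mapsto> \<langle>y\<rangle> \<lambda>\<^sup>x (Q x @ y)\<close> and \<open>R \<mapsto> \<lambda>\<^sup>x \<langle>y\<rangle> ((R @ y) x)\<close> are inverse to each other up to judgmental
  equality, by \<open>\<beta>\<close> and \<open>\<eta>\<close> for paths and bridges, and a judgmental isomorphism is a half adjoint
  equivalence all of whose coherence data are reflexivities. The exchange of \<open>x\<close> and \<open>y\<close> is possible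
  because path variables survive the cut at a bridge variable.
\<close>

(* Keeps weakenings in the shape "M \<up> 1" of the typing rules instead of "M \<up> Suc 0". *)
declare One_nat_def [simp del]

section \<open>Substitution calculus\<close>

text \<open>The difficulty lies less in the two maps than in the apartness condition on bridge
  application: \<open>Q x\<close> is typed by checking \<open>Q\<close> in the context cut at
  \<open>x\<close>, where \<open>x\<close> has become a \<open>Blank\<close>. A term of
  \<open>\<Gamma>\<close> that is used under \<open>x\<close> and \<open>y\<close> must therefore be
  weakened by \<open>Blank\<close> and \<open>PVar\<close> instead of \<open>BVar\<close> and
  \<open>PVar\<close>, and weakening over a bridge variable of \<open>\<Gamma>\<close> itself meets
  the same condition. This is why weakening is proved for arbitrary extensions of the context, and
  why the computation rules of the two maps relate a context \<open>\<Delta>\<close> to its cut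
  \<open>\<Gamma>\<close>. The inverse laws then come from a copy of all the data weakened into that
  cut context. That a type is well formed is never read off from a derivation of one of its
  elements; type formation is proved alongside, wherever a rule asks for it.\<close>

lemma up_Var_comp: "up (\<lambda>i. Var (f i)) = (\<lambda>i. Var (upr f i))"
  by (rule ext) (simp add: up_def upr_def scons_def wkn_def split: nat.split)

lemma ren_eq_subst: "ren f M = subst (\<lambda>i. Var (f i)) M"
proof (induction M arbitrary: f)
  case (Com A r s M Ns)
  then show ?case
    by (auto simp: up_Var_comp intro!: eqn.map_cong)
qed (simp_all add: up_Var_comp)

lemma subst_Var [simp]: "subst Var M = M"
proof -
  have up: "up Var = Var"
    by (rule ext) (simp add: up_def scons_def wkn_def split: nat.split)
  show ?thesis
  proof (induction M)
    case (Com A r s M Ns)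
    \<comment> \<open>The tubes are pairs in a list, so their induction hypotheses (for the
      dimensions of a face and for the tube term) are available entry by entry.\<close>
    have "map_prod (map_eqn (subst Var)) (subst Var) p = p" if "p \<in> set Ns" for p
      using Com(5)[OF that] Com(6)[OF that] by (cases p) (auto intro: eqn.map_ident_strong)
    then show ?case
      using Com by (simp add: up map_idI)
  qed (simp_all add: up)
qed

lemma subst_ren: "subst \<sigma> (ren f M) = subst (\<lambda>i. \<sigma> (f i)) M"
proof -
  have up: "(\<lambda>i. up \<sigma> (upr f i)) = up (\<lambda>i. \<sigma> (f i))" for f \<sigma>
    by (rule ext) (simp add: up_def upr_def scons_def split: nat.split)
  show ?thesis
  proof (induction M arbitrary: f \<sigma>)
    case (Com A r s M Ns)
    have "map_prod (map_eqn (subst \<sigma>)) (subst (up \<sigma>)) (map_prod (map_eqn (ren f)) (ren (upr f)) p) =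
        map_prod (map_eqn (subst (\<lambda>i. \<sigma> (f i)))) (subst (up (\<lambda>i. \<sigma> (f i)))) p" if "p \<in> set Ns" for p
      using Com(5)[OF that] Com(6)[OF that]
      by (cases p) (auto simp: up eqn.map_comp intro!: eqn.map_cong)
    then show ?case
      using Com by (simp add: up)
  qed (simp_all add: up)
qed

lemma ren_subst: "ren f (subst \<sigma> M) = subst (\<lambda>i. ren f (\<sigma> i)) M"
proof -
  have up: "(\<lambda>i. ren (upr f) (up \<sigma> i)) = up (\<lambda>i. ren f (\<sigma> i))" for f \<sigma>
    by (rule ext) (simp add: up_def upr_def scons_def wkn_def One_nat_def ren_eq_subst[of _ "ren _ _"]
        ren_eq_subst subst_ren[unfolded ren_eq_subst] split: nat.split)
  show ?thesis
  proof (induction M arbitrary: f \<sigma>)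
    case (Com A r s M Ns)
    have "map_prod (map_eqn (ren f)) (ren (upr f)) (map_prod (map_eqn (subst \<sigma>)) (subst (up \<sigma>)) p) =
        map_prod (map_eqn (subst (\<lambda>i. ren f (\<sigma> i)))) (subst (up (\<lambda>i. ren f (\<sigma> i)))) p"
      if "p \<in> set Ns" for p
      using Com(5)[OF that] Com(6)[OF that]
      by (cases p) (auto simp: up eqn.map_comp intro!: eqn.map_cong)
    then show ?case
      using Com by (simp add: up)
  qed (simp_all add: up)
qed

text \<open>Under a binder \<open>up\<close> weakens the terms of a substitution. Fusing two
  substitutions therefore rests on both mixed compositions with renamings, \<open>subst_ren\<close>
  and \<open>ren_subst\<close>, which come first.\<close>

lemma subst_subst: "subst \<sigma> (subst \<tau> M) = subst (\<lambda>i. subst \<sigma> (\<tau> i)) M"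
proof -
  have up: "(\<lambda>i. subst (up \<sigma>) (up \<tau> i)) = up (\<lambda>i. subst \<sigma> (\<tau> i))" for \<sigma> \<tau>
    by (rule ext) (simp add: up_def scons_def wkn_def One_nat_def subst_ren ren_subst split: nat.split)
  show ?thesis
  proof (induction M arbitrary: \<sigma> \<tau>)
    case (Com A r s M Ns)
    have "map_prod (map_eqn (subst \<sigma>)) (subst (up \<sigma>)) (map_prod (map_eqn (subst \<tau>)) (subst (up \<tau>)) p) =
        map_prod (map_eqn (subst (\<lambda>i. subst \<sigma> (\<tau> i)))) (subst (up (\<lambda>i. subst \<sigma> (\<tau> i)))) p"
      if "p \<in> set Ns" for p
      using Com(5)[OF that] Com(6)[OF that]
      by (cases p) (auto simp: up eqn.map_comp intro!: eqn.map_cong)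
    then show ?case
      using Com by (simp add: up)
  qed (simp_all add: up)
qed

lemma subst_ext: "(\<And>i. \<sigma> i = \<tau> i) \<Longrightarrow> subst \<sigma> M = subst \<tau> M"
  by (metis ext)

lemma subst_id: "(\<And>i. \<sigma> i = Var i) \<Longrightarrow> subst \<sigma> M = M"
  by (metis ext subst_Var)

lemma subst_id': "(\<And>i. \<sigma> i = Var i) \<Longrightarrow> M = subst \<sigma> M"
  by (simp add: subst_id)

lemma wkn_eq_subst: "M \<up> n = subst (\<lambda>i. Var (n + i)) M"
  by (simp add: wkn_def ren_eq_subst)

text \<open>A decision procedure for identities between instantiated terms: weakening, instantiation
  and exchange all become \<open>subst\<close>, composites are fused, and the two resulting
  substitutions are compared variable by variable.\<close>

lemmas sub_simps = wkn_eq_subst inst_def swap01_def ren_eq_subst subst_subst up_def scons_def One_nat_def numeral_eq_Suc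
lemmas sub_intros = subst_ext subst_id subst_id'


section \<open>Well-formed contexts\<close>

lemma ok_tl: "ok (e # \<Gamma>) \<Longrightarrow> ok \<Gamma>"
  by (erule ok.cases) auto

lemma ok_append: "ok (Es @ \<Gamma>) \<Longrightarrow> ok \<Gamma>"
  by (induction Es) (auto dest: ok_tl)

lemma ok_HypD: "ok (\<Gamma> \<triangleright> Hyp A) \<Longrightarrow> \<Gamma> \<turnstile> A \<Colon> Ty"
  by (erule ok.cases) auto

lemma ok_EqnD: "ok (\<Gamma> \<triangleright> Eqn \<xi>) \<Longrightarrow> face \<Gamma> \<xi>"
  by (erule ok.cases) auto

text \<open>A premise in an extended context yields the shorter one by \<open>ok_tl\<close>. The
  rules with a premise in a cut context carry \<open>ok\<close> explicitly, because well-formedness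
  of a cut says nothing about the blanked entries.\<close>

lemma judgment_ok:
  "ok \<Gamma> \<Longrightarrow> True"
  "\<Gamma> \<turnstile> M \<Colon> A \<Longrightarrow> ok \<Gamma>"
  "\<Gamma> \<turnstile> M \<approx> N \<Colon> A \<Longrightarrow> ok \<Gamma>"
  "\<Delta> \<tturnstile> \<sigma> \<Colon> \<Gamma> \<Longrightarrow> ok \<Delta>"
  by (induction rule: ok_typing_equal_substn.inducts) (auto dest: ok_tl)

lemmas typing_ok = judgment_ok(2)

lemma ok_HypI: "\<Gamma> \<turnstile> A \<Colon> Ty \<Longrightarrow> ok (\<Gamma> \<triangleright> Hyp A)"
  by (intro ok_hyp typing_ok)

lemma length_cut_at [simp]: "length (cut_at \<Gamma> i) = length \<Gamma>"
  by (induction \<Gamma> i rule: cut_at.induct) auto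

lemma cut_at_dim:
  "j < length \<Gamma> \<Longrightarrow> \<Gamma> ! j \<in> {PVar, BVar} \<Longrightarrow> j \<noteq> i \<Longrightarrow> cut_at \<Gamma> i ! j = \<Gamma> ! j"
proof (induction \<Gamma> i arbitrary: j rule: cut_at.induct)
  case (2 e \<Gamma>)
  then show ?case by (cases j) auto
next
  case (3 e \<Gamma> i)
  then show ?case by (cases j) auto
qed simp

lemma face_cut_at: "face \<Gamma> \<xi> \<Longrightarrow> Var i \<notin> set_eqn \<xi> \<Longrightarrow> face (cut_at \<Gamma> i) \<xi>"
  by (cases \<xi>) (auto simp: pdim_def bdim_def cut_at_dim)

text \<open>Every later entry whose type could mention the removed variable is blanked, and an
  equation that survives mentions only dimensions other than it, which keep their sort by
  \<open>cut_at_dim\<close>.\<close>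

lemma ok_cut_at: "ok \<Gamma> \<Longrightarrow> ok (cut_at \<Gamma> i)"
proof (induction \<Gamma> i rule: cut_at.induct)
  case (2 e \<Gamma>)
  then show ?case by (auto intro: ok_blank dest: ok_tl)
next
  case (3 e \<Gamma> i)
  then have IH: "ok (cut_at \<Gamma> i)"
    by (auto dest: ok_tl)
  show ?case
    by (cases e) (use 3(2) IH in \<open>auto intro: ok_blank ok_path ok_bridge ok_eqn face_cut_at dest: ok_EqnD\<close>)
qed simp

text \<open>What happens inside the prefix is irrelevant: the shift substitution depends only on its
  length.\<close>

lemma cut_at_append:
  "\<exists>Es'. length Es' = length Es \<and> cut_at (Es @ e # \<Gamma>) (length Es) = Es' @ Blank # \<Gamma>"
proof (induction Es)
  case (Cons a Es)
  then obtain Es' where "length Es' = length Es" "cut_at (Es @ e # \<Gamma>) (length Es) = Es' @ Blank # \<Gamma>"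
    by blast
  then show ?case
    by (intro exI[of _ "cut_var (length Es) a # Es'"]) simp
qed simp

section \<open>Weakening as a well-typed substitution\<close>

lemma substn_scons_iff: "(\<Delta> \<tturnstile> \<sigma> \<Colon> \<Gamma>) \<longleftrightarrow> (\<Delta> \<tturnstile> \<sigma> 0 \<cdot> (\<lambda>i. \<sigma> (Suc i)) \<Colon> \<Gamma>)"
proof -
  have "\<sigma> 0 \<cdot> (\<lambda>i. \<sigma> (Suc i)) = \<sigma>"
    by (rule ext) (simp add: scons_def split: nat.split)
  then show ?thesis by simp
qed

text \<open>
  \<open>Es\<close> has to be arbitrary: at a bridge variable of \<open>\<Gamma>\<close> the tail of the substitution must be typed
  in a cut context, in which part of \<open>Es\<close> and the variable itself have been blanked out.
\<close>

lemma substn_shift: "ok (Es @ \<Gamma>) \<Longrightarrow> Es @ \<Gamma> \<tturnstile> (\<lambda>i. Var (length Es + i)) \<Colon> \<Gamma>"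
proof (induction \<Gamma> arbitrary: Es)
  case Nil
  then show ?case by (simp add: s_nil)
next
  case (Cons e \<Gamma>)
  let ?n = "length Es"
  have tail: "(Es @ [e]) @ \<Gamma> \<tturnstile> (\<lambda>i. Var (Suc ?n + i)) \<Colon> \<Gamma>"
    using Cons.IH[of "Es @ [e]"] Cons.prems by simp
  have okG: "ok (e # \<Gamma>)"
    using Cons.prems by (rule ok_append)
  have "Es @ e # \<Gamma> \<tturnstile> Var ?n \<cdot> (\<lambda>i. Var (Suc ?n + i)) \<Colon> e # \<Gamma>"
  proof (cases e)
    case (Hyp A)
    have "Es @ e # \<Gamma> \<turnstile> Var ?n \<Colon> A \<up> Suc ?n"
      using Cons.prems Hyp by (intro t_var) auto
    with Hyp tail okG show ?thesis
      by (auto intro!: s_hyp ok_HypD simp: wkn_eq_subst)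
  next
    case BVar
    obtain Es' where Es': "length Es' = ?n" "cut_at (Es @ e # \<Gamma>) ?n = Es' @ Blank # \<Gamma>"
      using cut_at_append by blast
    have "ok ((Es' @ [Blank]) @ \<Gamma>)"
      using ok_cut_at[OF Cons.prems, of ?n] Es' by simp
    from Cons.IH[OF this] BVar Es' Cons.prems show ?thesis
      by (auto intro!: s_bridge simp: cut_def bdim_def)
  next
    case (Eqn \<xi>)
    have "holds (Es @ e # \<Gamma>) (\<xi> \<Up> Suc ?n)"
      using Eqn by (intro holds_hyp) auto
    then show ?thesis
      using Eqn tail okG
      by (auto intro!: s_eqn ok_EqnD simp: wkn_eqn_def wkn_eq_subst)
  qed (use tail in \<open>auto intro!: s_path s_blank simp: pdim_def\<close>)
  then show ?case
    by (subst substn_scons_iff) simp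
qed

lemma substn_id: "ok \<Gamma> \<Longrightarrow> \<Gamma> \<tturnstile> Var \<Colon> \<Gamma>"
  using substn_shift[of "[]" \<Gamma>] by simp

lemma substn_up_Hyp:
  assumes "ok (\<Gamma> \<triangleright> Hyp A)" "ok (Es @ \<Gamma>)"
  shows "(Es @ \<Gamma>) \<triangleright> Hyp (A \<up> length Es) \<tturnstile> up (\<lambda>i. Var (length Es + i)) \<Colon> \<Gamma> \<triangleright> Hyp A"
proof -
  have A: "\<Gamma> \<turnstile> A \<Colon> Ty"
    using assms(1) by (rule ok_HypD)
  have ok: "ok ((Es @ \<Gamma>) \<triangleright> Hyp (A \<up> length Es))"
    using t_sub[OF A substn_shift[OF assms(2)]] assms(2) by (intro ok_hyp) (simp_all add: wkn_eq_subst)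
  have "(Es @ \<Gamma>) \<triangleright> Hyp (A \<up> length Es) \<tturnstile> (\<lambda>i. Var (Suc (length Es) + i)) \<Colon> \<Gamma>"
    using substn_shift[of "Hyp (A \<up> length Es) # Es" \<Gamma>] ok by simp
  moreover have "(Es @ \<Gamma>) \<triangleright> Hyp (A \<up> length Es) \<turnstile> Var 0 \<Colon> subst (\<lambda>i. Var (Suc (length Es) + i)) A"
    using t_var[OF ok, of 0] by (auto simp: sub_simps)
  ultimately have "(Es @ \<Gamma>) \<triangleright> Hyp (A \<up> length Es) \<tturnstile> Var 0 \<cdot> (\<lambda>i. Var (Suc (length Es) + i)) \<Colon> \<Gamma> \<triangleright> Hyp A"
    using A by (intro s_hyp)
  then show ?thesis
    by (simp add: up_def wkn_def One_nat_def)
qed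

section \<open>Derived rules\<close>

lemma t_wkn: "\<Gamma> \<turnstile> M \<Colon> A \<Longrightarrow> ok (Es @ \<Gamma>) \<Longrightarrow> Es @ \<Gamma> \<turnstile> M \<up> length Es \<Colon> A \<up> length Es"
  unfolding wkn_eq_subst by (rule t_sub[OF _ substn_shift])

lemma e_wkn: "\<Gamma> \<turnstile> M \<approx> N \<Colon> A \<Longrightarrow> ok (Es @ \<Gamma>) \<Longrightarrow> Es @ \<Gamma> \<turnstile> M \<up> length Es \<approx> N \<up> length Es \<Colon> A \<up> length Es"
  unfolding wkn_eq_subst by (rule e_sub[OF _ substn_shift])

lemma t_wkn1: "\<Gamma> \<turnstile> M \<Colon> A \<Longrightarrow> ok (\<Gamma> \<triangleright> e) \<Longrightarrow> \<Gamma> \<triangleright> e \<turnstile> M \<up> 1 \<Colon> A \<up> 1"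
  using t_wkn[of \<Gamma> M A "[e]"] by (simp add: One_nat_def)

lemma e_wkn1: "\<Gamma> \<turnstile> M \<approx> N \<Colon> A \<Longrightarrow> ok (\<Gamma> \<triangleright> e) \<Longrightarrow> \<Gamma> \<triangleright> e \<turnstile> M \<up> 1 \<approx> N \<up> 1 \<Colon> A \<up> 1"
  using e_wkn[of \<Gamma> M N A "[e]"] by (simp add: One_nat_def)

lemma wkn_Ty [simp]: "Ty \<up> n = Ty"
  by (simp add: wkn_def)

lemma wkn1_inst [simp]: "(M \<up> 1)\<langle>N\<rangle> = M"
  by (auto simp: sub_simps intro!: sub_intros)

lemma wkn_Var [simp]: "Var i \<up> n = Var (n + i)"
  by (simp add: wkn_def)

lemma wkn_PApp [simp]: "PApp Q r \<up> n = PApp (Q \<up> n) (r \<up> n)" "PZero \<up> n = PZero" "POne \<up> n = POne"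
  by (simp_all add: wkn_def)

lemma wkn_BApp [simp]: "BApp Q r \<up> n = BApp (Q \<up> n) (r \<up> n)"
  by (simp add: wkn_def)

lemma wkn_wkn [simp]: "M \<up> m \<up> n = M \<up> (m + n)"
  by (auto simp: sub_simps intro!: sub_intros)

lemma wkn_steps:
  "M \<up> 1 \<up> 1 = M \<up> 2" "M \<up> 2 \<up> 1 = M \<up> 3" "Var 0 \<up> 1 = Var 1" "Var 1 \<up> 1 = Var 2"
  by (simp_all add: numeral_eq_Suc)

lemma t_Var0: "ok (\<Gamma> \<triangleright> Hyp A) \<Longrightarrow> \<Gamma> \<triangleright> Hyp A \<turnstile> Var 0 \<Colon> A \<up> 1"
  using t_var[of "\<Gamma> \<triangleright> Hyp A" 0 A] by (simp add: One_nat_def)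

lemma t_Ty_wkn1: "\<Gamma> \<turnstile> A \<Colon> Ty \<Longrightarrow> ok (\<Gamma> \<triangleright> e) \<Longrightarrow> \<Gamma> \<triangleright> e \<turnstile> A \<up> 1 \<Colon> Ty"
  by (drule (1) t_wkn1) simp

lemma t_Fn: "\<Gamma> \<turnstile> A \<Colon> Ty \<Longrightarrow> \<Gamma> \<turnstile> B \<Colon> Ty \<Longrightarrow> \<Gamma> \<turnstile> Fn A B \<Colon> Ty"
  unfolding Fn_def by (rule t_Pi) (auto intro: t_Ty_wkn1 ok_hyp typing_ok)

lemma wkn_Fn: "Fn A B \<up> n = Fn (A \<up> n) (B \<up> n)"
  by (auto simp: Fn_def sub_simps intro!: sub_intros)

lemma t_fapp: "\<Gamma> \<turnstile> f \<Colon> Fn A B \<Longrightarrow> \<Gamma> \<turnstile> a \<Colon> A \<Longrightarrow> \<Gamma> \<turnstile> App f a \<Colon> B"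
  using t_App[of \<Gamma> f A "B \<up> 1" a] by (simp add: Fn_def)

lemma e_fapp: "\<Gamma> \<turnstile> f \<Colon> Fn A B \<Longrightarrow> \<Gamma> \<turnstile> a \<approx> b \<Colon> A \<Longrightarrow> \<Gamma> \<turnstile> App f a \<approx> App f b \<Colon> B"
  using e_App[of \<Gamma> f f A "B \<up> 1" a b] by (simp add: Fn_def e_refl)

lemma t_Id: "\<Gamma> \<turnstile> A \<Colon> Ty \<Longrightarrow> \<Gamma> \<turnstile> M \<Colon> A \<Longrightarrow> \<Gamma> \<turnstile> N \<Colon> A \<Longrightarrow> \<Gamma> \<turnstile> Id A M N \<Colon> Ty"
  unfolding Id_def by (rule t_Path) (auto intro: t_Ty_wkn1 ok_path typing_ok)

text \<open>Boundaries of path abstractions hold up to judgmental equality, so a constant path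
  inhabits the identity type of any two terms equal to \<open>M\<close>, without a conversion of
  types.\<close>

lemma t_Id_refl:
  assumes "\<Gamma> \<turnstile> M \<Colon> A" "\<Gamma> \<turnstile> M \<approx> N \<Colon> A" "\<Gamma> \<turnstile> M \<approx> N' \<Colon> A"
  shows "\<Gamma> \<turnstile> PLam (M \<up> 1) \<Colon> Id A N N'"
  unfolding Id_def using assms
  by (intro t_PLam t_wkn1 ok_path) (auto intro: typing_ok)

lemma e_Id:
  assumes "\<Gamma> \<turnstile> A \<Colon> Ty" "\<Gamma> \<turnstile> M \<approx> M' \<Colon> A" "\<Gamma> \<turnstile> N \<approx> N' \<Colon> A"
  shows "\<Gamma> \<turnstile> Id A M N \<approx> Id A M' N' \<Colon> Ty"
  unfolding Id_def using assms
  by (intro e_Path e_refl t_Ty_wkn1 ok_path typing_ok[OF assms(1)]) auto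

lemma t_Id_app: "\<Gamma> \<turnstile> p \<Colon> Id A M N \<Longrightarrow> pdim \<Gamma> r \<Longrightarrow> \<Gamma> \<turnstile> PApp p r \<Colon> A"
  using t_PApp[of \<Gamma> p "A \<up> 1" M N r] by (simp add: Id_def)

lemma e_Id_zero: "\<Gamma> \<turnstile> p \<Colon> Id A M N \<Longrightarrow> \<Gamma> \<turnstile> PApp p PZero \<approx> M \<Colon> A"
  using e_Path_zero[of \<Gamma> p "A \<up> 1" M N] by (simp add: Id_def)

lemma e_Id_one: "\<Gamma> \<turnstile> p \<Colon> Id A M N \<Longrightarrow> \<Gamma> \<turnstile> PApp p POne \<approx> N \<Colon> A"
  using e_Path_one[of \<Gamma> p "A \<up> 1" M N] by (simp add: Id_def)


section \<open>Judgmental isomorphisms are equivalences\<close>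

text \<open>The homotopy \<open>g \<circ> f ~ id\<close>; with \<open>f\<close> and \<open>g\<close>
  exchanged it is also the type of \<open>\<epsilon>\<close>. Explicit arguments replace the indices
  by which the nested sum refers to its earlier components, so that substitution acts on the
  arguments alone.\<close>

definition RetrT :: "tm \<Rightarrow> tm \<Rightarrow> tm \<Rightarrow> tm" where
  "RetrT A f g = Pi A (Id (A \<up> 1) (App (g \<up> 1) (App (f \<up> 1) (Var 0))) (Var 0))"

definition CohT :: "tm \<Rightarrow> tm \<Rightarrow> tm \<Rightarrow> tm \<Rightarrow> tm \<Rightarrow> tm \<Rightarrow> tm" where
  "CohT A B f g h k = Pi A
     (Id (Id (B \<up> 1) (App (f \<up> 1) (App (g \<up> 1) (App (f \<up> 1) (Var 0)))) (App (f \<up> 1) (Var 0)))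
       (PLam (App (f \<up> 2) (PApp (App (h \<up> 2) (Var 1)) (Var 0))))
       (App (k \<up> 1) (App (f \<up> 1) (Var 0))))"

lemma IsEquiv_eq: "IsEquiv A B f =
  Sig (Fn B A) (Sig (RetrT (A \<up> 1) (f \<up> 1) (Var 0)) (Sig (RetrT (B \<up> 2) (Var 1) (f \<up> 2))
    (CohT (A \<up> 3) (B \<up> 3) (f \<up> 3) (Var 2) (Var 1) (Var 0))))"
  by (simp add: IsEquiv_def RetrT_def CohT_def)

lemma subst_RetrT: "subst \<sigma> (RetrT A f g) = RetrT (subst \<sigma> A) (subst \<sigma> f) (subst \<sigma> g)"
  by (auto simp: RetrT_def Id_def sub_simps intro!: sub_intros)

lemma wkn_RetrT: "RetrT A f g \<up> n = RetrT (A \<up> n) (f \<up> n) (g \<up> n)"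
  by (simp add: wkn_eq_subst subst_RetrT)

lemma subst_CohT: "subst \<sigma> (CohT A B f g h k) =
    CohT (subst \<sigma> A) (subst \<sigma> B) (subst \<sigma> f) (subst \<sigma> g) (subst \<sigma> h) (subst \<sigma> k)"
  by (auto simp: CohT_def Id_def sub_simps numeral_2_eq_2 intro!: sub_intros)

lemma subst_IsEquiv: "subst \<sigma> (IsEquiv A B f) = IsEquiv (subst \<sigma> A) (subst \<sigma> B) (subst \<sigma> f)"
  by (auto simp: IsEquiv_eq Fn_def subst_RetrT subst_CohT sub_simps intro!: sub_intros)

lemma t_RetrT:
  assumes A: "\<Gamma> \<turnstile> A \<Colon> Ty" and f: "\<Gamma> \<turnstile> f \<Colon> Fn A B" and g: "\<Gamma> \<turnstile> g \<Colon> Fn B A"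
  shows "\<Gamma> \<turnstile> RetrT A f g \<Colon> Ty"
proof -
  have ok: "ok (\<Gamma> \<triangleright> Hyp A)"
    using A by (intro ok_hyp) (auto intro: typing_ok)
  note f' = t_wkn1[OF f ok, unfolded wkn_Fn] and g' = t_wkn1[OF g ok, unfolded wkn_Fn]
  show ?thesis
    unfolding RetrT_def
    by (intro t_Pi A t_Id t_Ty_wkn1 ok t_fapp[OF g'] t_fapp[OF f'] t_Var0) auto
qed

lemma t_RetrT_app: "\<Gamma> \<turnstile> h \<Colon> RetrT A f g \<Longrightarrow> \<Gamma> \<turnstile> a \<Colon> A \<Longrightarrow> \<Gamma> \<turnstile> App h a \<Colon> Id A (App g (App f a)) a"
  unfolding RetrT_def by (drule (1) t_App) (simp add: Id_def sub_simps)

text \<open>The only nontrivial point is that \<open>ap f (h a)\<close> is a path from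
  \<open>f (g (f a))\<close> to \<open>f a\<close>: its endpoints are \<open>f\<close> applied to
  the endpoints of \<open>h a\<close>.\<close>

lemma t_CohT:
  assumes A: "\<Gamma> \<turnstile> A \<Colon> Ty" and B: "\<Gamma> \<turnstile> B \<Colon> Ty"
    and f: "\<Gamma> \<turnstile> f \<Colon> Fn A B" and g: "\<Gamma> \<turnstile> g \<Colon> Fn B A"
    and h: "\<Gamma> \<turnstile> h \<Colon> RetrT A f g" and k: "\<Gamma> \<turnstile> k \<Colon> RetrT B g f"
  shows "\<Gamma> \<turnstile> CohT A B f g h k \<Colon> Ty"
proof -
  have ok: "ok (\<Gamma> \<triangleright> Hyp A)"
    using A by (intro ok_hyp) (auto intro: typing_ok)
  have ok2: "ok (\<Gamma> \<triangleright> Hyp A \<triangleright> PVar)"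
    using ok by (rule ok_path)
  note f1 = t_wkn1[OF f ok, unfolded wkn_Fn] and g1 = t_wkn1[OF g ok, unfolded wkn_Fn]
  note h1 = t_wkn1[OF h ok, unfolded wkn_RetrT]
    and k1 = t_wkn1[OF k ok, unfolded wkn_RetrT]
  note a = t_Var0[OF ok]
  note fa = t_fapp[OF f1 a]
  note ha = t_RetrT_app[OF h1 a]
  have ha2: "\<Gamma> \<triangleright> Hyp A \<triangleright> PVar \<turnstile> App (h \<up> 2) (Var 1) \<Colon>
      Id (A \<up> 2) (App (g \<up> 2) (App (f \<up> 2) (Var 1))) (Var 1)"
    using t_wkn1[OF ha ok2] by (simp add: Id_def sub_simps)
  have f2: "\<Gamma> \<triangleright> Hyp A \<triangleright> PVar \<turnstile> f \<up> 2 \<Colon> Fn (A \<up> 2) (B \<up> 2)"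
    using t_wkn1[OF f1 ok2] by (simp add: wkn_Fn)
  have "\<Gamma> \<triangleright> Hyp A \<turnstile> PLam (App (f \<up> 2) (PApp (App (h \<up> 2) (Var 1)) (Var 0))) \<Colon>
      Id (B \<up> 1) (App (f \<up> 1) (App (g \<up> 1) (App (f \<up> 1) (Var 0)))) (App (f \<up> 1) (Var 0))"
    unfolding Id_def
  proof (rule t_PLam)
    show "\<Gamma> \<triangleright> Hyp A \<triangleright> PVar \<turnstile> App (f \<up> 2) (PApp (App (h \<up> 2) (Var 1)) (Var 0)) \<Colon> B \<up> 1 \<up> 1"
      using t_fapp[OF f2 t_Id_app[OF ha2, of "Var 0"]] by (simp add: pdim_def)
  qed (use e_fapp[OF f1 e_Id_zero[OF ha]] e_fapp[OF f1 e_Id_one[OF ha]] in \<open>simp_all add: sub_simps\<close>)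
  then show ?thesis
    unfolding CohT_def
    by (intro t_Pi A t_Id t_Ty_wkn1 B ok t_fapp[OF f1] t_fapp[OF g1] a t_RetrT_app[OF k1]) auto
qed

text \<open>\<open>t_Pair\<close> requires the family of the sum to be a type, so the nested sum is
  formed from the inside out. Here \<open>k\<close> is the variable of the family; in the next three
  lemmas it is \<open>h\<close>, then \<open>g\<close>, then \<open>f\<close>.\<close>

lemma t_CohT_fibre:
  assumes A: "\<Gamma> \<turnstile> A \<Colon> Ty" and B: "\<Gamma> \<turnstile> B \<Colon> Ty"
    and f: "\<Gamma> \<turnstile> f \<Colon> Fn A B" and g: "\<Gamma> \<turnstile> g \<Colon> Fn B A" and h: "\<Gamma> \<turnstile> h \<Colon> RetrT A f g"
  shows "\<Gamma> \<triangleright> Hyp (RetrT B g f) \<turnstile> CohT (A \<up> 1) (B \<up> 1) (f \<up> 1) (g \<up> 1) (h \<up> 1) (Var 0) \<Colon> Ty"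
proof -
  have ok: "ok (\<Gamma> \<triangleright> Hyp (RetrT B g f))"
    by (rule ok_HypI[OF t_RetrT[OF B g f]])
  show ?thesis
    by (rule t_CohT[OF t_Ty_wkn1[OF A ok] t_Ty_wkn1[OF B ok] t_wkn1[OF f ok, unfolded wkn_Fn]
          t_wkn1[OF g ok, unfolded wkn_Fn] t_wkn1[OF h ok, unfolded wkn_RetrT]
          t_Var0[OF ok, unfolded wkn_RetrT]])
qed

lemma t_RetrT_fibre:
  assumes A: "\<Gamma> \<turnstile> A \<Colon> Ty" and B: "\<Gamma> \<turnstile> B \<Colon> Ty"
    and f: "\<Gamma> \<turnstile> f \<Colon> Fn A B" and g: "\<Gamma> \<turnstile> g \<Colon> Fn B A"
  shows "\<Gamma> \<triangleright> Hyp (RetrT A f g) \<turnstile> Sig (RetrT (B \<up> 1) (g \<up> 1) (f \<up> 1))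
      (CohT (A \<up> 2) (B \<up> 2) (f \<up> 2) (g \<up> 2) (Var 1) (Var 0)) \<Colon> Ty"
proof -
  have ok: "ok (\<Gamma> \<triangleright> Hyp (RetrT A f g))"
    by (rule ok_HypI[OF t_RetrT[OF A f g]])
  note A1 = t_Ty_wkn1[OF A ok] and B1 = t_Ty_wkn1[OF B ok]
    and f1 = t_wkn1[OF f ok, unfolded wkn_Fn] and g1 = t_wkn1[OF g ok, unfolded wkn_Fn]
  from t_CohT_fibre[OF A1 B1 f1 g1 t_Var0[OF ok, unfolded wkn_RetrT]] t_RetrT[OF B1 g1 f1]
  show ?thesis
    unfolding wkn_steps by (intro t_Sig) auto
qed

lemma t_IsEquiv_fibre:
  assumes A: "\<Gamma> \<turnstile> A \<Colon> Ty" and B: "\<Gamma> \<turnstile> B \<Colon> Ty" and f: "\<Gamma> \<turnstile> f \<Colon> Fn A B"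
  shows "\<Gamma> \<triangleright> Hyp (Fn B A) \<turnstile> Sig (RetrT (A \<up> 1) (f \<up> 1) (Var 0))
    (Sig (RetrT (B \<up> 2) (Var 1) (f \<up> 2))
      (CohT (A \<up> 3) (B \<up> 3) (f \<up> 3) (Var 2) (Var 1) (Var 0))) \<Colon> Ty"
proof -
  have ok: "ok (\<Gamma> \<triangleright> Hyp (Fn B A))"
    by (rule ok_HypI[OF t_Fn[OF B A]])
  note A1 = t_Ty_wkn1[OF A ok] and B1 = t_Ty_wkn1[OF B ok]
    and f1 = t_wkn1[OF f ok, unfolded wkn_Fn] and g1 = t_Var0[OF ok, unfolded wkn_Fn]
  from t_RetrT_fibre[OF A1 B1 f1 g1] t_RetrT[OF A1 f1 g1]
  show ?thesis
    unfolding wkn_steps by - (rule t_Sig, auto)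
qed

lemma t_Equiv_fibre:
  assumes A: "\<Gamma> \<turnstile> A \<Colon> Ty" and B: "\<Gamma> \<turnstile> B \<Colon> Ty"
  shows "\<Gamma> \<triangleright> Hyp (Fn A B) \<turnstile> IsEquiv (A \<up> 1) (B \<up> 1) (Var 0) \<Colon> Ty"
proof -
  have ok: "ok (\<Gamma> \<triangleright> Hyp (Fn A B))"
    by (rule ok_HypI[OF t_Fn[OF A B]])
  note A1 = t_Ty_wkn1[OF A ok] and B1 = t_Ty_wkn1[OF B ok] and f1 = t_Var0[OF ok, unfolded wkn_Fn]
  show ?thesis
    unfolding IsEquiv_eq by (intro t_Sig t_Fn[OF B1 A1] t_IsEquiv_fibre[OF A1 B1 f1]) auto
qed

text \<open>Both homotopies are reflexivity. The coherence then compares \<open>ap f\<close> of a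
  constant path with the constant path at \<open>f a\<close>, and these agree judgmentally by
  \<beta>.\<close>

lemma Equiv_of_judgmental_iso:
  assumes A: "\<Gamma> \<turnstile> A \<Colon> Ty" and B: "\<Gamma> \<turnstile> B \<Colon> Ty"
    and f: "\<Gamma> \<turnstile> f \<Colon> Fn A B" and g: "\<Gamma> \<turnstile> g \<Colon> Fn B A"
    and gf: "\<Gamma> \<triangleright> Hyp A \<turnstile> App (g \<up> 1) (App (f \<up> 1) (Var 0)) \<approx> Var 0 \<Colon> A \<up> 1"
    and fg: "\<Gamma> \<triangleright> Hyp B \<turnstile> App (f \<up> 1) (App (g \<up> 1) (Var 0)) \<approx> Var 0 \<Colon> B \<up> 1"
  shows "\<exists>E. \<Gamma> \<turnstile> E \<Colon> Equiv A B"
proof -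
  \<comment> \<open>\<open>\<lambda>a. \<langle>_\<rangle> a\<close>; \<open>Var 1\<close> skips the
    path variable. Being closed, the same term serves for both homotopies and is fixed by every
    substitution.\<close>
  let ?r = "Lam (PLam (Var 1))"
  have refl: "\<Gamma> \<turnstile> ?r \<Colon> RetrT A' f' g'"
    if "\<Gamma> \<triangleright> Hyp A' \<turnstile> App (g' \<up> 1) (App (f' \<up> 1) (Var 0)) \<approx> Var 0 \<Colon> A' \<up> 1" for A' f' g'
  proof -
    have "\<Gamma> \<triangleright> Hyp A' \<turnstile> Var 0 \<Colon> A' \<up> 1"
      by (rule t_Var0) (rule judgment_ok(3)[OF that])
    from t_Id_refl[OF this e_sym[OF that] e_refl[OF this]] show ?thesis
      unfolding RetrT_def wkn_steps by (rule t_Lam)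
  qed
  have r_beta: "\<Delta> \<turnstile> App ?r b \<approx> PLam (b \<up> 1) \<Colon> Id C b b" if b: "\<Delta> \<turnstile> b \<Colon> C" and C: "\<Delta> \<turnstile> C \<Colon> Ty" for \<Delta> b C
  proof -
    note v = t_Var0[OF ok_HypI[OF C]]
    have "\<Delta> \<triangleright> Hyp C \<turnstile> PLam (Var 1) \<Colon> Id (C \<up> 1) (Var 0) (Var 0)"
      using t_Id_refl[OF v e_refl[OF v] e_refl[OF v]] unfolding wkn_steps .
    from e_Pi_beta[OF this b] show ?thesis
      by (simp add: Id_def sub_simps)
  qed
  note h = refl[OF gf] and k = refl[OF fg]
  have ok: "ok (\<Gamma> \<triangleright> Hyp A)"
    by (rule judgment_ok(3)[OF gf])
  then have okP: "ok (\<Gamma> \<triangleright> Hyp A \<triangleright> PVar)"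
    by (rule ok_path)
  note a = t_Var0[OF ok] and A1 = t_Ty_wkn1[OF A ok] and B1 = t_Ty_wkn1[OF B ok]
  note f1 = t_wkn1[OF f ok, unfolded wkn_Fn]
  note f2 = t_wkn1[OF f1 okP, unfolded wkn_Fn wkn_steps] and A2 = t_Ty_wkn1[OF A1 okP, unfolded wkn_steps]
  note a2 = t_wkn1[OF a okP, unfolded wkn_steps]
  let ?fa = "App (f \<up> 1) (Var 0)"
  note fa = t_fapp[OF f1 a]
  note fgf = e_fapp[OF f1 gf]
  let ?T = "Id (B \<up> 1) (App (f \<up> 1) (App (g \<up> 1) ?fa)) ?fa"
  \<comment> \<open>The common value of both sides of the coherence; \<open>fgf\<close> allows
    \<open>f (g (f a))\<close> as its source.\<close>
  have cell: "\<Gamma> \<triangleright> Hyp A \<turnstile> PLam (?fa \<up> 1) \<Colon> ?T"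
    by (rule t_Id_refl[OF fa e_sym[OF fgf] e_refl[OF fa]])
  \<comment> \<open>\<open>r_beta\<close> gives this equation at the type of loops at
    \<open>f a\<close>; the conversion replaces the source along \<open>fgf\<close>.\<close>
  have right: "\<Gamma> \<triangleright> Hyp A \<turnstile> PLam (?fa \<up> 1) \<approx> App ?r ?fa \<Colon> ?T"
    by (rule e_conv[OF e_sym[OF r_beta[OF fa B1]] e_Id[OF B1 e_sym[OF fgf] e_refl[OF fa]]])
  have left: "\<Gamma> \<triangleright> Hyp A \<turnstile> PLam (?fa \<up> 1) \<approx> PLam (App (f \<up> 2) (PApp (App ?r (Var 1)) (Var 0))) \<Colon> ?T"
    unfolding Id_def
  proof (rule e_PLam)
    have v0: "pdim (\<Gamma> \<triangleright> Hyp A \<triangleright> PVar) (Var 0)"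
      by (simp add: pdim_def)
    \<comment> \<open>Under the path variable, \<open>(?r a) @ y\<close> takes two \<beta>-steps to
      \<open>a\<close>: one for functions, one for paths.\<close>
    have "\<Gamma> \<triangleright> Hyp A \<triangleright> PVar \<turnstile> PApp (App ?r (Var 1)) (Var 0) \<approx> PApp (PLam (Var 2)) (Var 0) \<Colon> A \<up> 2"
      using e_PApp[OF r_beta[OF a2 A2, unfolded Id_def] v0 v0 path_refl[OF v0]] by (simp add: wkn_steps) (simp add: sub_simps)
    moreover have "\<Gamma> \<triangleright> Hyp A \<triangleright> PVar \<turnstile> PApp (PLam (Var 2)) (Var 0) \<approx> Var 1 \<Colon> A \<up> 2"
      using e_Path_beta[OF t_wkn1[OF a2 ok_path[OF okP]] v0] by (simp add: wkn_steps) (simp add: sub_simps)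
    ultimately have "\<Gamma> \<triangleright> Hyp A \<triangleright> PVar \<turnstile> Var 1 \<approx> PApp (App ?r (Var 1)) (Var 0) \<Colon> A \<up> 2"
      by (blast intro: e_trans e_sym)
    from e_fapp[OF f2 this]
    show "\<Gamma> \<triangleright> Hyp A \<triangleright> PVar \<turnstile> ?fa \<up> 1 \<approx> App (f \<up> 2) (PApp (App ?r (Var 1)) (Var 0)) \<Colon> B \<up> 1 \<up> 1"
      by (simp add: sub_simps)
  qed (use e_sym[OF fgf] e_refl[OF fa] in \<open>simp_all only: wkn1_inst\<close>)
  have coh: "\<Gamma> \<turnstile> Lam (PLam (PLam (?fa \<up> 1) \<up> 1)) \<Colon> CohT A B f g ?r ?r"
    unfolding CohT_def using t_Id_refl[OF cell left right] by (intro t_Lam) (simp add: sub_simps)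
  have "\<Gamma> \<turnstile> Pair ?r (Lam (PLam (PLam (?fa \<up> 1) \<up> 1))) \<Colon>
      Sig (RetrT B g f) (CohT (A \<up> 1) (B \<up> 1) (f \<up> 1) (g \<up> 1) (?r \<up> 1) (Var 0))"
    by (rule t_Pair[OF t_CohT_fibre[OF A B f g h] k]) (use coh in \<open>simp add: subst_RetrT subst_CohT sub_simps\<close>)
  then have "\<Gamma> \<turnstile> Pair ?r (Pair ?r (Lam (PLam (PLam (?fa \<up> 1) \<up> 1)))) \<Colon> Sig (RetrT A f g)
      (Sig (RetrT (B \<up> 1) (g \<up> 1) (f \<up> 1)) (CohT (A \<up> 2) (B \<up> 2) (f \<up> 2) (g \<up> 2) (Var 1) (Var 0)))"
    by (intro t_Pair[OF t_RetrT_fibre[OF A B f g] h]) (simp add: subst_RetrT subst_CohT sub_simps)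
  then have "\<Gamma> \<turnstile> Pair g (Pair ?r (Pair ?r (Lam (PLam (PLam (?fa \<up> 1) \<up> 1))))) \<Colon> IsEquiv A B f"
    unfolding IsEquiv_eq
    by (intro t_Pair[OF t_IsEquiv_fibre[OF A B f] g]) (simp add: subst_RetrT subst_CohT sub_simps)
  then have "\<Gamma> \<turnstile> Pair f (Pair g (Pair ?r (Pair ?r (Lam (PLam (PLam (?fa \<up> 1) \<up> 1)))))) \<Colon> Equiv A B"
    unfolding Equiv_def
    by (intro t_Pair[OF t_Equiv_fibre[OF A B] f]) (simp add: subst_IsEquiv sub_simps)
  then show ?thesis
    by blast
qed

section \<open>Extensionality of paths and bridges\<close>

lemma cut_simps [simp]:
  "cut \<Gamma> BZero = \<Gamma>" "cut \<Gamma> BOne = \<Gamma>" "cut (e # \<Gamma>) (Var 0) = \<Gamma> \<triangleright> Blank"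
  "cut (PVar # e # \<Gamma>) (Var 1) = \<Gamma> \<triangleright> Blank \<triangleright> PVar"
  by (simp_all add: cut_def One_nat_def)

text \<open>Lets a bridge application \<open>(R @ y) s\<close> be typed under a fresh path variable
  \<open>y\<close>.\<close>

lemma cut_PVar: "bdim \<Delta> s \<Longrightarrow> cut (\<Delta> \<triangleright> PVar) (s \<up> 1) = cut \<Delta> s \<triangleright> PVar"
  by (auto simp: bdim_def cut_def wkn_def One_nat_def)

lemma dim_simps [simp]:
  "pdim \<Gamma> PZero" "pdim \<Gamma> POne" "bdim \<Gamma> BZero" "bdim \<Gamma> BOne"
  "pdim (\<Gamma> \<triangleright> PVar) (Var 0)" "bdim (\<Gamma> \<triangleright> BVar) (Var 0)"
  "pdim (\<Gamma> \<triangleright> PVar \<triangleright> e) (Var 1)" "bdim (\<Gamma> \<triangleright> BVar \<triangleright> e) (Var 1)"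
  by (simp_all add: pdim_def bdim_def)

lemma pdim_wkn1: "pdim \<Gamma> r \<Longrightarrow> pdim (\<Gamma> \<triangleright> e) (r \<up> 1)"
  by (auto simp: pdim_def wkn_def One_nat_def)

lemma bdim_wkn1: "bdim \<Gamma> r \<Longrightarrow> bdim (\<Gamma> \<triangleright> e) (r \<up> 1)"
  by (auto simp: bdim_def wkn_def One_nat_def)

lemma PApp_cong: "\<Gamma> \<turnstile> Q \<approx> Q' \<Colon> PathT A M N \<Longrightarrow> pdim \<Gamma> r \<Longrightarrow> \<Gamma> \<turnstile> PApp Q r \<approx> PApp Q' r \<Colon> A\<langle>r\<rangle>"
  by (intro e_PApp path_refl)

lemma BApp_cong:
  "ok \<Gamma> \<Longrightarrow> bdim \<Gamma> r \<Longrightarrow> cut \<Gamma> r \<turnstile> Q \<approx> Q' \<Colon> BridgeT A M N \<Longrightarrow> \<Gamma> \<turnstile> BApp Q r \<approx> BApp Q' r \<Colon> A\<langle>r\<rangle>"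
  by (intro e_BApp bridge_refl)

text \<open>By \<eta> both sides are abstractions, and the congruence rule asks for the boundary of
  the first body only, which the endpoint rules for \<open>Q\<close> supply.\<close>

lemma Path_ext:
  assumes Q: "\<Gamma> \<turnstile> Q \<Colon> PathT A M N" and Q': "\<Gamma> \<turnstile> Q' \<Colon> PathT A M N"
    and eq: "\<Gamma> \<triangleright> PVar \<turnstile> PApp (Q \<up> 1) (Var 0) \<approx> PApp (Q' \<up> 1) (Var 0) \<Colon> A"
  shows "\<Gamma> \<turnstile> Q \<approx> Q' \<Colon> PathT A M N"
proof -
  have "\<Gamma> \<turnstile> PLam (PApp (Q \<up> 1) (Var 0)) \<approx> PLam (PApp (Q' \<up> 1) (Var 0)) \<Colon> PathT A M N"
    by (rule e_PLam[OF eq])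
      (use e_Path_zero[OF Q] e_Path_one[OF Q] in \<open>simp_all add: sub_simps\<close>)
  then show ?thesis
    using e_Path_eta[OF Q] e_Path_eta[OF Q'] by (blast intro: e_trans e_sym)
qed

lemma Bridge_ext:
  assumes Q: "\<Gamma> \<turnstile> Q \<Colon> BridgeT A M N" and Q': "\<Gamma> \<turnstile> Q' \<Colon> BridgeT A M N"
    and eq: "\<Gamma> \<triangleright> BVar \<turnstile> BApp (Q \<up> 1) (Var 0) \<approx> BApp (Q' \<up> 1) (Var 0) \<Colon> A"
  shows "\<Gamma> \<turnstile> Q \<approx> Q' \<Colon> BridgeT A M N"
proof -
  have "\<Gamma> \<turnstile> BLam (BApp (Q \<up> 1) (Var 0)) \<approx> BLam (BApp (Q' \<up> 1) (Var 0)) \<Colon> BridgeT A M N"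
    by (rule e_BLam[OF eq])
      (use e_Bridge_zero[OF Q] e_Bridge_one[OF Q] in \<open>simp_all add: sub_simps\<close>)
  then show ?thesis
    using e_Bridge_eta[OF Q] e_Bridge_eta[OF Q'] by (blast intro: e_trans e_sym)
qed


section \<open>Exchanging a path and a bridge dimension\<close>

abbreviation shift :: "nat \<Rightarrow> nat \<Rightarrow> tm" where
  "shift n \<equiv> \<lambda>i. Var (n + i)"

text \<open>The path variable is the outer entry of the target, so its image is checked in the full
  context. Only the tail below the bridge variable has to live in the cut context, and that tail is
  a weakening by \<open>PVar\<close> and \<open>Blank\<close>.\<close>

lemma substn_swap: "ok \<Gamma> \<Longrightarrow> \<Gamma> \<triangleright> PVar \<triangleright> BVar \<tturnstile> Var 1 \<cdot> Var 0 \<cdot> shift 2 \<Colon> \<Gamma> \<triangleright> BVar \<triangleright> PVar"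
  using substn_shift[of "[Blank, PVar]" \<Gamma>]
  by (intro s_path s_bridge) (auto intro: ok_path ok_bridge ok_blank simp: numeral_2_eq_2)

lemma substn_up_BVar:
  "ok (Es @ \<Gamma>) \<Longrightarrow> (Es @ \<Gamma>) \<triangleright> BVar \<tturnstile> up (shift (length Es)) \<Colon> \<Gamma> \<triangleright> BVar"
  using substn_shift[of "Blank # Es" \<Gamma>] unfolding up_def
  by (intro s_bridge) (auto intro: ok_bridge ok_blank simp: One_nat_def)

lemma substn_up_BVar_PVar:
  assumes "ok (Es @ \<Gamma>)"
  shows "(Es @ \<Gamma>) \<triangleright> BVar \<triangleright> PVar \<tturnstile> up (up (shift (length Es))) \<Colon> \<Gamma> \<triangleright> BVar \<triangleright> PVar"
proof -
  have "(Es @ \<Gamma>) \<triangleright> BVar \<triangleright> PVar \<tturnstile> Var 1 \<cdot> shift (Suc (Suc (length Es))) \<Colon> \<Gamma> \<triangleright> BVar"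
    using substn_shift[of "PVar # Blank # Es" \<Gamma>] assms
    by (intro s_bridge) (auto intro: ok_bridge ok_path ok_blank)
  moreover have "(\<lambda>i. up (shift (length Es)) i \<up> 1) = Var 1 \<cdot> shift (Suc (Suc (length Es)))"
    by (rule ext) (auto simp: sub_simps split: nat.split)
  ultimately show ?thesis
    unfolding up_def[of "up _"] by (intro s_path) auto
qed

section \<open>The two types and the two maps\<close>

definition BridgePathT :: "tm \<Rightarrow> tm \<Rightarrow> tm \<Rightarrow> tm \<Rightarrow> tm \<Rightarrow> tm" where
  "BridgePathT A M N P Q = BridgeT (PathT A M N) P Q"

definition PathBridgeT :: "tm \<Rightarrow> tm \<Rightarrow> tm \<Rightarrow> tm \<Rightarrow> tm \<Rightarrow> tm" where
  "PathBridgeT A M N P Q =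
     PathT (BridgeT (swap01 A) (PApp (P \<up> 1) (Var 0)) (PApp (Q \<up> 1) (Var 0))) (BLam M) (BLam N)"

text \<open>Under both binders index 0 is the bridge variable and index 1 the path variable; in
  \<open>bwd\<close> the roles are reversed.\<close>

definition fwd :: "tm \<Rightarrow> tm" where
  "fwd Q = PLam (BLam (PApp (BApp (Q \<up> 2) (Var 0)) (Var 1)))"

definition bwd :: "tm \<Rightarrow> tm" where
  "bwd R = BLam (PLam (BApp (PApp (R \<up> 2) (Var 0)) (Var 1)))"

lemma subst_fwd: "subst \<sigma> (fwd Q) = fwd (subst \<sigma> Q)"
  by (auto simp: fwd_def sub_simps intro!: sub_intros)

lemma subst_bwd: "subst \<sigma> (bwd Q) = bwd (subst \<sigma> Q)"
  by (auto simp: bwd_def sub_simps intro!: sub_intros)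

lemma wkn_BridgePathT: "BridgePathT A M N P Q \<up> n =
    BridgePathT (subst (up (up (shift n))) A) (subst (up (shift n)) M) (subst (up (shift n)) N) (P \<up> n) (Q \<up> n)"
  by (simp add: BridgePathT_def wkn_eq_subst)

lemma wkn_PathBridgeT: "PathBridgeT A M N P Q \<up> n =
    PathBridgeT (subst (up (up (shift n))) A) (subst (up (shift n)) M) (subst (up (shift n)) N) (P \<up> n) (Q \<up> n)"
  by (auto simp: PathBridgeT_def sub_simps split: nat.split intro!: sub_intros)

lemma inst_PathT: "(PathT A M N)\<langle>s\<rangle> = PathT (subst (up (s \<cdot> Var)) A) (M\<langle>s\<rangle>) (N\<langle>s\<rangle>)"
  by (simp add: inst_def)

lemma inst_up: "(subst (up (s \<cdot> Var)) A)\<langle>r\<rangle> = subst (r \<cdot> s \<cdot> Var) A"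
  by (auto simp: sub_simps split: nat.split intro!: sub_intros)

text \<open>Restricted to constants because the outer instantiation would also act on a variable
  \<open>r\<close>.\<close>

lemma inst_inst: "r = PZero \<or> r = POne \<Longrightarrow> (A\<langle>r\<rangle>)\<langle>s\<rangle> = subst (r \<cdot> s \<cdot> Var) A"
  by (auto simp: sub_simps split: nat.split intro!: sub_intros)

lemma t_BridgePathT_app:
  assumes "ok \<Delta>" "bdim \<Delta> s" "pdim \<Delta> r" "cut \<Delta> s \<turnstile> Q \<Colon> BridgePathT A M N P P'"
  shows "\<Delta> \<turnstile> BApp Q s \<Colon> PathT (subst (up (s \<cdot> Var)) A) (M\<langle>s\<rangle>) (N\<langle>s\<rangle>)"
    and "\<Delta> \<turnstile> PApp (BApp Q s) r \<Colon> subst (r \<cdot> s \<cdot> Var) A"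
proof -
  show *: "\<Delta> \<turnstile> BApp Q s \<Colon> PathT (subst (up (s \<cdot> Var)) A) (M\<langle>s\<rangle>) (N\<langle>s\<rangle>)"
    using t_BApp[OF assms(1,2,4)[unfolded BridgePathT_def]] by (simp add: inst_def)
  show "\<Delta> \<turnstile> PApp (BApp Q s) r \<Colon> subst (r \<cdot> s \<cdot> Var) A"
    using t_PApp[OF * assms(3)] by (simp add: inst_up)
qed

lemma inst_PathBridgeT_fibre:
  "(BridgeT (swap01 A) (PApp (P \<up> 1) (Var 0)) (PApp (P' \<up> 1) (Var 0)))\<langle>r\<rangle> =
    BridgeT (subst ((r \<up> 1) \<cdot> Var) A) (PApp P r) (PApp P' r)"
  by (auto simp: sub_simps split: nat.split intro!: sub_intros)

text \<open>Here the path application lies inside the bridge application and is checked in the cut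
  context, so \<open>r\<close> has to be a path term there. In \<open>t_BridgePathT_app\<close> it
  is outermost, and \<open>r\<close> is a path term of \<open>\<Delta>\<close>.\<close>

lemma t_PathBridgeT_app:
  assumes "ok \<Delta>" "bdim \<Delta> s" "pdim (cut \<Delta> s) r" "cut \<Delta> s \<turnstile> R \<Colon> PathBridgeT A M N P P'"
  shows "cut \<Delta> s \<turnstile> PApp R r \<Colon> BridgeT (subst ((r \<up> 1) \<cdot> Var) A) (PApp P r) (PApp P' r)"
    and "\<Delta> \<turnstile> BApp (PApp R r) s \<Colon> subst (r \<cdot> s \<cdot> Var) A"
proof -
  show *: "cut \<Delta> s \<turnstile> PApp R r \<Colon> BridgeT (subst ((r \<up> 1) \<cdot> Var) A) (PApp P r) (PApp P' r)"
    using t_PApp[OF assms(4)[unfolded PathBridgeT_def] assms(3)] unfolding inst_PathBridgeT_fibre .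
  have "(subst ((r \<up> 1) \<cdot> Var) A)\<langle>s\<rangle> = subst (r \<cdot> s \<cdot> Var) A"
    by (auto simp: sub_simps split: nat.split intro!: sub_intros)
  then show "\<Delta> \<turnstile> BApp (PApp R r) s \<Colon> subst (r \<cdot> s \<cdot> Var) A"
    using t_BApp[OF assms(1,2) *] by simp
qed

text \<open>The data of the theorem form a locale so that \<open>wkn\<close> can provide a weakened
  copy of them, together with every result proved here.\<close>

locale bridge_square =
  fixes \<Gamma> :: ctx and A M0 M1 P0 P1 :: tm
  assumes A: "\<Gamma> \<triangleright> BVar \<triangleright> PVar \<turnstile> A \<Colon> Ty"
    and M0: "\<Gamma> \<triangleright> BVar \<turnstile> M0 \<Colon> A\<langle>PZero\<rangle>"
    and M1: "\<Gamma> \<triangleright> BVar \<turnstile> M1 \<Colon> A\<langle>POne\<rangle>"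
    and P0: "\<Gamma> \<turnstile> P0 \<Colon> (PathT A M0 M1)\<langle>BZero\<rangle>"
    and P1: "\<Gamma> \<turnstile> P1 \<Colon> (PathT A M0 M1)\<langle>BOne\<rangle>"
begin

lemma ok: "ok \<Gamma>"
  using P0 by (rule typing_ok)

lemma oks [simp]: "ok (\<Gamma> \<triangleright> BVar)" "ok (\<Gamma> \<triangleright> PVar)" "ok (\<Gamma> \<triangleright> Blank)" "ok (\<Gamma> \<triangleright> BVar \<triangleright> PVar)"
  "ok (\<Gamma> \<triangleright> PVar \<triangleright> BVar)" "ok (\<Gamma> \<triangleright> Blank \<triangleright> PVar)" "ok (\<Gamma> \<triangleright> PVar \<triangleright> Blank)"
  using ok by (auto intro: ok_path ok_bridge ok_blank)

lemma wkn:
  assumes "ok (Es @ \<Gamma>)"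
  defines "\<sigma> \<equiv> shift (length Es)"
  shows "bridge_square (Es @ \<Gamma>) (subst (up (up \<sigma>)) A) (subst (up \<sigma>) M0) (subst (up \<sigma>) M1)
    (P0 \<up> length Es) (P1 \<up> length Es)"
proof
  show "(Es @ \<Gamma>) \<triangleright> BVar \<triangleright> PVar \<turnstile> subst (up (up \<sigma>)) A \<Colon> Ty"
    using t_sub[OF A substn_up_BVar_PVar[OF assms(1)]] by (simp add: \<sigma>_def)
  have inst: "subst (up \<tau>) (M\<langle>N\<rangle>) = (subst (up (up \<tau>)) M)\<langle>subst (up \<tau>) N\<rangle>" for \<tau> M N
    by (auto simp: sub_simps split: nat.split intro!: sub_intros)
  show "(Es @ \<Gamma>) \<triangleright> BVar \<turnstile> subst (up \<sigma>) M0 \<Colon> (subst (up (up \<sigma>)) A)\<langle>PZero\<rangle>"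
    using t_sub[OF M0 substn_up_BVar[OF assms(1)]] by (simp add: \<sigma>_def inst)
  show "(Es @ \<Gamma>) \<triangleright> BVar \<turnstile> subst (up \<sigma>) M1 \<Colon> (subst (up (up \<sigma>)) A)\<langle>POne\<rangle>"
    using t_sub[OF M1 substn_up_BVar[OF assms(1)]] by (simp add: \<sigma>_def inst)
  have inst': "(T\<langle>r\<rangle>) \<up> length Es = (subst (up \<sigma>) T)\<langle>r\<rangle>" if "r = BZero \<or> r = BOne" for T r
    using that by (auto simp: sub_simps \<sigma>_def split: nat.split intro!: sub_intros)
  show "Es @ \<Gamma> \<turnstile> P0 \<up> length Es \<Colon>
      (PathT (subst (up (up \<sigma>)) A) (subst (up \<sigma>) M0) (subst (up \<sigma>) M1))\<langle>BZero\<rangle>"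
    using t_wkn[OF P0 assms(1)] by (simp add: inst')
  show "Es @ \<Gamma> \<turnstile> P1 \<up> length Es \<Colon>
      (PathT (subst (up (up \<sigma>)) A) (subst (up \<sigma>) M0) (subst (up \<sigma>) M1))\<langle>BOne\<rangle>"
    using t_wkn[OF P1 assms(1)] by (simp add: inst')
qed

lemma swap_A: "\<Gamma> \<triangleright> PVar \<triangleright> BVar \<turnstile> swap01 A \<Colon> Ty"
proof -
  have "swap01 A = subst (Var 1 \<cdot> Var 0 \<cdot> shift 2) A"
    by (auto simp: sub_simps split: nat.split intro!: sub_intros)
  then show ?thesis
    using t_sub[OF A substn_swap[OF ok]] by simp
qed

lemma t_BridgePathT: "\<Gamma> \<turnstile> BridgePathT A M0 M1 P0 P1 \<Colon> Ty"
  unfolding BridgePathT_def by (rule t_Bridge[OF _ t_Path[OF _ A M0 M1] P0 P1]) auto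

lemma P_types:
  "\<Gamma> \<turnstile> P0 \<Colon> PathT (subst (up (BZero \<cdot> Var)) A) (M0\<langle>BZero\<rangle>) (M1\<langle>BZero\<rangle>)"
  "\<Gamma> \<turnstile> P1 \<Colon> PathT (subst (up (BOne \<cdot> Var)) A) (M0\<langle>BOne\<rangle>) (M1\<langle>BOne\<rangle>)"
  using P0 P1 by (simp_all add: inst_def)

lemma P_app:
  assumes "pdim \<Gamma> r"
  shows "\<Gamma> \<turnstile> PApp P0 r \<Colon> subst (r \<cdot> BZero \<cdot> Var) A" and "\<Gamma> \<turnstile> PApp P1 r \<Colon> subst (r \<cdot> BOne \<cdot> Var) A"
  using t_PApp[OF P_types(1) assms] t_PApp[OF P_types(2) assms] by (simp_all add: inst_up)

lemma P_ends:
  "\<Gamma> \<turnstile> PApp P0 PZero \<approx> M0\<langle>BZero\<rangle> \<Colon> (A\<langle>PZero\<rangle>)\<langle>BZero\<rangle>" "\<Gamma> \<turnstile> PApp P0 POne \<approx> M1\<langle>BZero\<rangle> \<Colon> (A\<langle>POne\<rangle>)\<langle>BZero\<rangle>"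
  "\<Gamma> \<turnstile> PApp P1 PZero \<approx> M0\<langle>BOne\<rangle> \<Colon> (A\<langle>PZero\<rangle>)\<langle>BOne\<rangle>" "\<Gamma> \<turnstile> PApp P1 POne \<approx> M1\<langle>BOne\<rangle> \<Colon> (A\<langle>POne\<rangle>)\<langle>BOne\<rangle>"
  using P_types[THEN e_Path_zero] P_types[THEN e_Path_one] by (simp_all add: inst_up inst_inst)

text \<open>At the ends of the path the fibre has endpoints such as \<open>P0 @ 0\<close> where
  \<open>BLam M0\<close> has an instance of \<open>M0\<close>; the boundary premises of
  \<open>t_BLam\<close> absorb the difference.\<close>

lemma t_BLam_M:
  "\<Gamma> \<turnstile> BLam M0 \<Colon> BridgeT (A\<langle>PZero\<rangle>) (PApp P0 PZero) (PApp P1 PZero)"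
  "\<Gamma> \<turnstile> BLam M1 \<Colon> BridgeT (A\<langle>POne\<rangle>) (PApp P0 POne) (PApp P1 POne)"
  by (intro t_BLam M0 M1 e_sym[OF P_ends(1)] e_sym[OF P_ends(2)] e_sym[OF P_ends(3)] e_sym[OF P_ends(4)])+

abbreviation "fibre \<equiv> BridgeT (swap01 A) (PApp (P0 \<up> 1) (Var 0)) (PApp (P1 \<up> 1) (Var 0))"

lemma wkn_P_app:
  "\<Gamma> \<triangleright> PVar \<turnstile> PApp (P0 \<up> 1) (Var 0) \<Colon> (swap01 A)\<langle>BZero\<rangle>"
  "\<Gamma> \<triangleright> PVar \<turnstile> PApp (P1 \<up> 1) (Var 0) \<Colon> (swap01 A)\<langle>BOne\<rangle>"
proof -
  interpret w: bridge_square "\<Gamma> \<triangleright> PVar" "subst (up (up (shift 1))) A" "subst (up (shift 1)) M0"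
    "subst (up (shift 1)) M1" "P0 \<up> 1" "P1 \<up> 1"
    using wkn[of "[PVar]"] by (simp add: One_nat_def)
  have eq: "subst (Var 0 \<cdot> r \<cdot> Var) (subst (up (up (shift 1))) A) = (swap01 A)\<langle>r\<rangle>" for r
    by (auto simp: sub_simps split: nat.split intro!: sub_intros)
  show "\<Gamma> \<triangleright> PVar \<turnstile> PApp (P0 \<up> 1) (Var 0) \<Colon> (swap01 A)\<langle>BZero\<rangle>"
    "\<Gamma> \<triangleright> PVar \<turnstile> PApp (P1 \<up> 1) (Var 0) \<Colon> (swap01 A)\<langle>BOne\<rangle>"
    using w.P_app[of "Var 0"] by (simp_all add: eq)
qed

lemma t_fibre: "\<Gamma> \<triangleright> PVar \<turnstile> fibre \<Colon> Ty"
  by (rule t_Bridge[OF _ swap_A wkn_P_app]) simp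

lemma inst_fibre: "fibre\<langle>r\<rangle> = BridgeT (subst ((r \<up> 1) \<cdot> Var) A) (PApp P0 r) (PApp P1 r)"
  by (rule inst_PathBridgeT_fibre)

lemma inst_fibre_const:
  "fibre\<langle>PZero\<rangle> = BridgeT (A\<langle>PZero\<rangle>) (PApp P0 PZero) (PApp P1 PZero)"
  "fibre\<langle>POne\<rangle> = BridgeT (A\<langle>POne\<rangle>) (PApp P0 POne) (PApp P1 POne)"
  unfolding inst_fibre by (simp_all add: wkn_def inst_def)

lemma t_PathBridgeT: "\<Gamma> \<turnstile> PathBridgeT A M0 M1 P0 P1 \<Colon> Ty"
  unfolding PathBridgeT_def
  by (rule t_Path[OF _ t_fibre]) (use t_BLam_M in \<open>simp_all add: inst_fibre_const\<close>)

lemma t_fwd_body: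
  assumes Q: "\<Gamma> \<turnstile> Q \<Colon> BridgePathT A M0 M1 P0 P1"
  shows "\<Gamma> \<triangleright> PVar \<triangleright> BVar \<turnstile> PApp (BApp (Q \<up> 2) (Var 0)) (Var 1) \<Colon> swap01 A"
    and "\<Gamma> \<triangleright> PVar \<turnstile> BLam (PApp (BApp (Q \<up> 2) (Var 0)) (Var 1)) \<Colon> fibre"
proof -
  \<comment> \<open>Cutting at the bridge variable leaves
    \<open>\<Gamma> \<triangleright> PVar \<triangleright> Blank\<close>, so \<open>Q\<close> is
    weakened into that context.\<close>
  have Q2: "cut (\<Gamma> \<triangleright> PVar \<triangleright> BVar) (Var 0) \<turnstile> Q \<up> 2 \<Colon> BridgePathT A M0 M1 P0 P1 \<up> 2"
    using t_wkn[OF Q, of "[Blank, PVar]"] by (simp add: numeral_2_eq_2)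
  have "subst (Var 1 \<cdot> Var 0 \<cdot> Var) (subst (up (up (shift 2))) A) = swap01 A"
    by (auto simp: sub_simps split: nat.split intro!: sub_intros)
  then show body: "\<Gamma> \<triangleright> PVar \<triangleright> BVar \<turnstile> PApp (BApp (Q \<up> 2) (Var 0)) (Var 1) \<Colon> swap01 A"
    using t_BridgePathT_app(2)[OF _ _ _ Q2[unfolded wkn_BridgePathT], of "Var 1"] by simp
  have Q1: "\<Gamma> \<triangleright> PVar \<turnstile> Q \<up> 1 \<Colon> BridgePathT A M0 M1 P0 P1 \<up> 1"
    by (rule t_wkn1[OF Q]) simp
  note Q1' = Q1[unfolded wkn_BridgePathT, unfolded BridgePathT_def]
  have inst: "(PathT (subst (up (up (shift 1))) A) X Y)\<langle>r\<rangle> =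
      PathT (subst (up (r \<cdot> shift 1)) A) (X\<langle>r\<rangle>) (Y\<langle>r\<rangle>)" for X Y r
    by (auto simp: sub_simps split: nat.split intro!: sub_intros)
  have inst2: "(subst (up (r \<cdot> shift 1)) A)\<langle>Var 0\<rangle> = (swap01 A)\<langle>r\<rangle>" for r
    by (auto simp: sub_simps split: nat.split intro!: sub_intros)
  have inst3: "(PApp (BApp (Q \<up> 2) (Var 0)) (Var 1))\<langle>r\<rangle> = PApp (BApp (Q \<up> 1) r) (Var 0)" for r
    by (auto simp: sub_simps split: nat.split intro!: sub_intros)
  have "\<Gamma> \<triangleright> PVar \<turnstile> PApp (BApp (Q \<up> 1) BZero) (Var 0) \<approx> PApp (P0 \<up> 1) (Var 0) \<Colon> (swap01 A)\<langle>BZero\<rangle>"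
    using PApp_cong[OF e_Bridge_zero[OF Q1', unfolded inst], of "Var 0"] by (simp add: inst2)
  moreover have "\<Gamma> \<triangleright> PVar \<turnstile> PApp (BApp (Q \<up> 1) BOne) (Var 0) \<approx> PApp (P1 \<up> 1) (Var 0) \<Colon> (swap01 A)\<langle>BOne\<rangle>"
    using PApp_cong[OF e_Bridge_one[OF Q1', unfolded inst], of "Var 0"] by (simp add: inst2)
  ultimately show "\<Gamma> \<triangleright> PVar \<turnstile> BLam (PApp (BApp (Q \<up> 2) (Var 0)) (Var 1)) \<Colon> fibre"
    by (intro t_BLam[OF body]) (simp_all add: inst3)
qed

lemma t_bridge_app:
  assumes Q: "\<Gamma> \<turnstile> Q \<Colon> BridgePathT A M0 M1 P0 P1"
  shows "\<Gamma> \<triangleright> BVar \<turnstile> BApp (Q \<up> 1) (Var 0) \<Colon> PathT A M0 M1"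
proof -
  have Q1: "cut (\<Gamma> \<triangleright> BVar) (Var 0) \<turnstile> Q \<up> 1 \<Colon> BridgePathT A M0 M1 P0 P1 \<up> 1"
    using t_wkn1[OF Q, of Blank] by simp
  have "subst (up (Var 0 \<cdot> Var)) (subst (up (up (shift 1))) A) = A"
    and "(subst (up (shift 1)) X)\<langle>Var 0\<rangle> = X" for X
    by (auto simp: sub_simps split: nat.split intro!: sub_intros)
  then show ?thesis
    \<comment> \<open>\<open>PZero\<close> is a placeholder for the path term \<open>r\<close>,
      which occurs only in the second claim.\<close>
    using t_BridgePathT_app(1)[OF _ _ _ Q1[unfolded wkn_BridgePathT], of PZero] by simp
qed

lemma t_fwd:
  assumes Q: "\<Gamma> \<turnstile> Q \<Colon> BridgePathT A M0 M1 P0 P1"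
  shows "\<Gamma> \<turnstile> fwd Q \<Colon> PathBridgeT A M0 M1 P0 P1"
proof -
  note q = t_bridge_app[OF Q]
  have Q': "\<Gamma> \<turnstile> Q \<Colon> BridgeT (PathT A M0 M1) P0 P1"
    using Q by (simp add: BridgePathT_def)
  \<comment> \<open>The bridge boundary that \<open>e_BLam\<close> asks for below; the endpoint
    equations themselves are checked under the bridge binder, where \<open>Q x\<close> is a path
    from \<open>M0\<close> to \<open>M1\<close>.\<close>
  have Qend: "\<Gamma> \<turnstile> PApp (BApp Q BZero) r \<approx> PApp P0 r \<Colon> subst (r \<cdot> BZero \<cdot> Var) A"
    "\<Gamma> \<turnstile> PApp (BApp Q BOne) r \<approx> PApp P1 r \<Colon> subst (r \<cdot> BOne \<cdot> Var) A" if "pdim \<Gamma> r" for r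
    using PApp_cong[OF e_Bridge_zero[OF Q', unfolded inst_PathT] that] PApp_cong[OF e_Bridge_one[OF Q', unfolded inst_PathT] that]
    by (simp_all add: inst_up)
  have inst: "(BLam (PApp (BApp (Q \<up> 2) (Var 0)) (Var 1)))\<langle>r\<rangle> = BLam (PApp (BApp (Q \<up> 1) (Var 0)) (r \<up> 1))" for r
    by (auto simp: sub_simps split: nat.split intro!: sub_intros)
  have inst2: "(PApp (BApp (Q \<up> 1) (Var 0)) (r \<up> 1))\<langle>s\<rangle> = PApp (BApp Q s) r" for r s
    by (auto simp: sub_simps split: nat.split intro!: sub_intros)
  show ?thesis
    unfolding fwd_def PathBridgeT_def
  proof (rule t_PLam[OF t_fwd_body(2)[OF Q]])
    have "\<Gamma> \<turnstile> BLam (PApp (BApp (Q \<up> 1) (Var 0)) (PZero \<up> 1)) \<approx> BLam M0 \<Colon>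
        BridgeT (A\<langle>PZero\<rangle>) (PApp P0 PZero) (PApp P1 PZero)"
      by (rule e_BLam) (use e_Path_zero[OF q] Qend[of PZero] in \<open>simp_all add: inst2[of PZero, simplified] inst_inst\<close>)
    then show "\<Gamma> \<turnstile> (BLam (PApp (BApp (Q \<up> 2) (Var 0)) (Var 1)))\<langle>PZero\<rangle> \<approx> BLam M0 \<Colon> fibre\<langle>PZero\<rangle>"
      unfolding inst inst_fibre_const .
    have "\<Gamma> \<turnstile> BLam (PApp (BApp (Q \<up> 1) (Var 0)) (POne \<up> 1)) \<approx> BLam M1 \<Colon>
        BridgeT (A\<langle>POne\<rangle>) (PApp P0 POne) (PApp P1 POne)"
      by (rule e_BLam) (use e_Path_one[OF q] Qend[of POne] in \<open>simp_all add: inst2[of POne, simplified] inst_inst\<close>)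
    then show "\<Gamma> \<turnstile> (BLam (PApp (BApp (Q \<up> 2) (Var 0)) (Var 1)))\<langle>POne\<rangle> \<approx> BLam M1 \<Colon> fibre\<langle>POne\<rangle>"
      unfolding inst inst_fibre_const .
  qed
qed

lemma t_path_app:
  assumes R: "\<Gamma> \<turnstile> R \<Colon> PathBridgeT A M0 M1 P0 P1"
  shows "\<Gamma> \<triangleright> PVar \<turnstile> PApp (R \<up> 1) (Var 0) \<Colon> fibre"
proof -
  \<comment> \<open>Cutting at a constant changes nothing, so the first claim of
    \<open>t_PathBridgeT_app\<close> can be used in the full context.\<close>
  have "cut (\<Gamma> \<triangleright> PVar) BZero \<turnstile> R \<up> 1 \<Colon> PathBridgeT A M0 M1 P0 P1 \<up> 1"
    using t_wkn1[OF R, of PVar] by simp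
  note * = t_PathBridgeT_app(1)[OF _ _ _ this[unfolded wkn_PathBridgeT], of "Var 0"]
  have "subst ((Var 0 \<up> 1) \<cdot> Var) (subst (up (up (shift 1))) A) = swap01 A"
    by (auto simp: sub_simps split: nat.split intro!: sub_intros)
  with * show ?thesis
    by simp
qed

lemma t_bwd_body:
  assumes R: "\<Gamma> \<turnstile> R \<Colon> PathBridgeT A M0 M1 P0 P1"
  shows "\<Gamma> \<triangleright> BVar \<triangleright> PVar \<turnstile> BApp (PApp (R \<up> 2) (Var 0)) (Var 1) \<Colon> A"
    and "\<Gamma> \<triangleright> BVar \<turnstile> PLam (BApp (PApp (R \<up> 2) (Var 0)) (Var 1)) \<Colon> PathT A M0 M1"
proof -
  \<comment> \<open>The cut at \<open>Var 1\<close> blanks the bridge variable but keeps the later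
    path variable, so \<open>R @ y\<close> can be formed in the cut context.\<close>
  have R2: "cut (\<Gamma> \<triangleright> BVar \<triangleright> PVar) (Var 1) \<turnstile> R \<up> 2 \<Colon> PathBridgeT A M0 M1 P0 P1 \<up> 2"
    using t_wkn[OF R, of "[PVar, Blank]"] by (simp add: numeral_2_eq_2)
  have "subst (Var 0 \<cdot> Var 1 \<cdot> Var) (subst (up (up (shift 2))) A) = A"
    by (auto simp: sub_simps split: nat.split intro!: sub_intros)
  then show body: "\<Gamma> \<triangleright> BVar \<triangleright> PVar \<turnstile> BApp (PApp (R \<up> 2) (Var 0)) (Var 1) \<Colon> A"
    using t_PathBridgeT_app(2)[OF _ _ _ R2[unfolded wkn_PathBridgeT], of "Var 0"] by simp
  have inst: "(BApp (PApp (R \<up> 2) (Var 0)) (Var 1))\<langle>r\<rangle> = BApp (PApp (R \<up> 1) r) (Var 0)" for r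
    by (auto simp: sub_simps split: nat.split intro!: sub_intros)
  have R1: "\<Gamma> \<turnstile> PApp R PZero \<approx> BLam M0 \<Colon> BridgeT (A\<langle>PZero\<rangle>) (PApp P0 PZero) (PApp P1 PZero)"
    "\<Gamma> \<turnstile> PApp R POne \<approx> BLam M1 \<Colon> BridgeT (A\<langle>POne\<rangle>) (PApp P0 POne) (PApp P1 POne)"
    using e_Path_zero[OF R[unfolded PathBridgeT_def]] e_Path_one[OF R[unfolded PathBridgeT_def]]
    unfolding inst_fibre_const by simp_all
  \<comment> \<open>Used for \<open>X = R @ 0\<close> and \<open>X = R @ 1\<close>: applying the
    equation to a fresh bridge variable and reducing recovers the body \<open>M0\<close> or
    \<open>M1\<close>.\<close>
  have end_eq: "\<Gamma> \<triangleright> BVar \<turnstile> BApp (X \<up> 1) (Var 0) \<approx> M \<Colon> C"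
    if eq: "\<Gamma> \<turnstile> X \<approx> BLam M \<Colon> BridgeT C N N'" and M: "\<Gamma> \<triangleright> BVar \<turnstile> M \<Colon> C" for X M C N N'
  proof -
    have C: "(subst (up (shift 1)) Y)\<langle>Var 0\<rangle> = Y" for Y
      by (auto simp: sub_simps split: nat.split intro!: sub_intros)
    have "cut (\<Gamma> \<triangleright> BVar) (Var 0) \<turnstile> X \<up> 1 \<approx> BLam M \<up> 1 \<Colon> BridgeT C N N' \<up> 1"
      using e_wkn1[OF eq, of Blank] by simp
    then have "\<Gamma> \<triangleright> BVar \<turnstile> BApp (X \<up> 1) (Var 0) \<approx> BApp (BLam M \<up> 1) (Var 0) \<Colon> C"
      using BApp_cong[of "\<Gamma> \<triangleright> BVar" "Var 0" "X \<up> 1" "BLam M \<up> 1" "subst (up (shift 1)) C"]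
      by (simp add: C) (simp add: wkn_eq_subst)
    moreover have "cut (\<Gamma> \<triangleright> BVar) (Var 0) \<triangleright> BVar \<turnstile> subst (up (shift 1)) M \<Colon> subst (up (shift 1)) C"
      using t_sub[OF M substn_up_BVar[of "[Blank]"]] by (simp add: One_nat_def)
    from e_Bridge_beta[OF _ _ this] have "\<Gamma> \<triangleright> BVar \<turnstile> BApp (BLam M \<up> 1) (Var 0) \<approx> M \<Colon> C"
      by (simp add: C wkn_eq_subst)
    ultimately show ?thesis
      by (rule e_trans)
  qed
  show "\<Gamma> \<triangleright> BVar \<turnstile> PLam (BApp (PApp (R \<up> 2) (Var 0)) (Var 1)) \<Colon> PathT A M0 M1"
    by (rule t_PLam[OF body]) (use end_eq[OF R1(1) M0] end_eq[OF R1(2) M1] in \<open>simp_all add: inst\<close>)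
qed

text \<open>At a bridge endpoint the body becomes \<open>\<langle>y\<rangle> (P0 @ y)\<close> or
  \<open>\<langle>y\<rangle> (P1 @ y)\<close>, and path \<eta> contracts it to the prescribed
  endpoint. In \<open>t_fwd\<close> the endpoints are abstractions already.\<close>

lemma t_bwd:
  assumes R: "\<Gamma> \<turnstile> R \<Colon> PathBridgeT A M0 M1 P0 P1"
  shows "\<Gamma> \<turnstile> bwd R \<Colon> BridgePathT A M0 M1 P0 P1"
proof -
  note r = t_path_app[OF R]
  have r_ends: "\<Gamma> \<turnstile> PApp R PZero \<Colon> BridgeT (A\<langle>PZero\<rangle>) (PApp P0 PZero) (PApp P1 PZero)"
    "\<Gamma> \<turnstile> PApp R POne \<Colon> BridgeT (A\<langle>POne\<rangle>) (PApp P0 POne) (PApp P1 POne)"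
    using t_PApp[OF R[unfolded PathBridgeT_def], of PZero] t_PApp[OF R[unfolded PathBridgeT_def], of POne]
    unfolding inst_fibre_const by simp_all
  have inst: "(PLam (BApp (PApp (R \<up> 2) (Var 0)) (Var 1)))\<langle>s\<rangle> = PLam (BApp (PApp (R \<up> 1) (Var 0)) (s \<up> 1))" for s
    by (auto simp: sub_simps split: nat.split intro!: sub_intros)
  have inst2: "(BApp (PApp (R \<up> 1) (Var 0)) (s \<up> 1))\<langle>r\<rangle> = BApp (PApp R r) s" for r s
    by (auto simp: sub_simps split: nat.split intro!: sub_intros)
  have inst3: "(swap01 A)\<langle>s\<rangle> = subst (up (s \<cdot> Var)) A" if "s = BZero \<or> s = BOne" for s
    using that by (auto simp: sub_simps split: nat.split intro!: sub_intros)
  have wkn_const: "BZero \<up> 1 = BZero" "BOne \<up> 1 = BOne"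
    by (simp_all add: wkn_def)
  have "\<Gamma> \<turnstile> PLam (BApp (PApp (R \<up> 1) (Var 0)) BZero) \<approx> PLam (PApp (P0 \<up> 1) (Var 0)) \<Colon> (PathT A M0 M1)\<langle>BZero\<rangle>"
    unfolding inst_PathT
    by (rule e_PLam)
      (use e_Bridge_zero[OF r] e_trans[OF e_Bridge_zero[OF r_ends(1)] P_ends(1)]
         e_trans[OF e_Bridge_zero[OF r_ends(2)] P_ends(2)]
       in \<open>simp_all add: inst2[of BZero, unfolded wkn_const] inst3 inst_up inst_inst\<close>)
  then have zero: "\<Gamma> \<turnstile> PLam (BApp (PApp (R \<up> 1) (Var 0)) BZero) \<approx> P0 \<Colon> (PathT A M0 M1)\<langle>BZero\<rangle>"
    by (rule e_trans) (use e_sym[OF e_Path_eta[OF P_types(1)]] in \<open>simp add: inst_PathT\<close>)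
  have "\<Gamma> \<turnstile> PLam (BApp (PApp (R \<up> 1) (Var 0)) BOne) \<approx> PLam (PApp (P1 \<up> 1) (Var 0)) \<Colon> (PathT A M0 M1)\<langle>BOne\<rangle>"
    unfolding inst_PathT
    by (rule e_PLam)
      (use e_Bridge_one[OF r] e_trans[OF e_Bridge_one[OF r_ends(1)] P_ends(3)]
         e_trans[OF e_Bridge_one[OF r_ends(2)] P_ends(4)]
       in \<open>simp_all add: inst2[of BOne, unfolded wkn_const] inst3 inst_up inst_inst\<close>)
  then have one: "\<Gamma> \<turnstile> PLam (BApp (PApp (R \<up> 1) (Var 0)) BOne) \<approx> P1 \<Colon> (PathT A M0 M1)\<langle>BOne\<rangle>"
    by (rule e_trans) (use e_sym[OF e_Path_eta[OF P_types(2)]] in \<open>simp add: inst_PathT\<close>)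
  show ?thesis
    unfolding BridgePathT_def bwd_def
    by (rule t_BLam[OF t_bwd_body(2)[OF R]]) (use zero one in \<open>simp_all add: inst wkn_const\<close>)
qed

section \<open>Computation rules and inverse laws\<close>

text \<open>The data live in the cut \<open>\<Gamma>\<close> of the context \<open>\<Delta>\<close>
  of the equation. This form covers a bridge variable \<open>s\<close>, for which \<open>Q\<close>
  has to be apart from \<open>s\<close>.\<close>

lemma fwd_beta:
  assumes \<Delta>: "ok \<Delta>" "bdim \<Delta> s" "cut \<Delta> s = \<Gamma>" and r: "pdim \<Gamma> r" "pdim \<Delta> r"
    and Q: "\<Gamma> \<turnstile> Q \<Colon> BridgePathT A M0 M1 P0 P1"
  shows "\<Delta> \<turnstile> BApp (PApp (fwd Q) r) s \<approx> PApp (BApp Q s) r \<Colon> subst (r \<cdot> s \<cdot> Var) A"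
proof -
  have inst: "(BLam (PApp (BApp (Q \<up> 2) (Var 0)) (Var 1)))\<langle>r\<rangle> = BLam (PApp (BApp (Q \<up> 1) (Var 0)) (r \<up> 1))"
    by (auto simp: sub_simps split: nat.split intro!: sub_intros)
  have inst2: "(PApp (BApp (Q \<up> 1) (Var 0)) (r \<up> 1))\<langle>s\<rangle> = PApp (BApp Q s) r"
    by (auto simp: sub_simps split: nat.split intro!: sub_intros)
  have inst3: "(subst ((r \<up> 1) \<cdot> Var) A)\<langle>s\<rangle> = subst (r \<cdot> s \<cdot> Var) A"
    by (auto simp: sub_simps split: nat.split intro!: sub_intros)
  have "\<Gamma> \<turnstile> PApp (fwd Q) r \<approx> BLam (PApp (BApp (Q \<up> 1) (Var 0)) (r \<up> 1)) \<Colon>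
      BridgeT (subst ((r \<up> 1) \<cdot> Var) A) (PApp P0 r) (PApp P1 r)"
    using e_Path_beta[OF t_fwd_body(2)[OF Q] r(1)] unfolding fwd_def inst inst_fibre .
  then have "\<Delta> \<turnstile> BApp (PApp (fwd Q) r) s \<approx> BApp (BLam (PApp (BApp (Q \<up> 1) (Var 0)) (r \<up> 1))) s \<Colon>
      subst (r \<cdot> s \<cdot> Var) A"
    using BApp_cong[OF \<Delta>(1,2)] \<Delta>(3) inst3 by metis
  moreover
  have "cut \<Delta> s \<triangleright> BVar \<turnstile> PApp (BApp (Q \<up> 1) (Var 0)) (r \<up> 1) \<Colon> A\<langle>r \<up> 1\<rangle>"
    using t_PApp[OF t_bridge_app[OF Q] pdim_wkn1[OF r(1)]] \<Delta>(3) by simp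
  from e_Bridge_beta[OF \<Delta>(1,2) this]
  have "\<Delta> \<turnstile> BApp (BLam (PApp (BApp (Q \<up> 1) (Var 0)) (r \<up> 1))) s \<approx> PApp (BApp Q s) r \<Colon> subst (r \<cdot> s \<cdot> Var) A"
    unfolding inst2 using inst3 by (simp add: inst_def)
  ultimately show ?thesis
    by (rule e_trans)
qed

lemma bwd_beta:
  assumes \<Delta>: "ok \<Delta>" "bdim \<Delta> s" "cut \<Delta> s = \<Gamma>" and r: "pdim \<Delta> r"
    and R: "\<Gamma> \<turnstile> R \<Colon> PathBridgeT A M0 M1 P0 P1"
  shows "\<Delta> \<turnstile> PApp (BApp (bwd R) s) r \<approx> BApp (PApp R r) s \<Colon> subst (r \<cdot> s \<cdot> Var) A"
proof -
  have inst: "(PLam (BApp (PApp (R \<up> 2) (Var 0)) (Var 1)))\<langle>s\<rangle> = PLam (BApp (PApp (R \<up> 1) (Var 0)) (s \<up> 1))"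
    by (auto simp: sub_simps split: nat.split intro!: sub_intros)
  have inst2: "(BApp (PApp (R \<up> 1) (Var 0)) (s \<up> 1))\<langle>r\<rangle> = BApp (PApp R r) s"
    by (auto simp: sub_simps split: nat.split intro!: sub_intros)
  have inst3: "(swap01 A)\<langle>s \<up> 1\<rangle> = subst (up (s \<cdot> Var)) A"
    by (auto simp: sub_simps split: nat.split intro!: sub_intros)
  have "\<Delta> \<turnstile> BApp (bwd R) s \<approx> PLam (BApp (PApp (R \<up> 1) (Var 0)) (s \<up> 1)) \<Colon>
      PathT (subst (up (s \<cdot> Var)) A) (M0\<langle>s\<rangle>) (M1\<langle>s\<rangle>)"
    using e_Bridge_beta[OF \<Delta>(1,2), unfolded \<Delta>(3), OF t_bwd_body(2)[OF R]]
    unfolding bwd_def inst inst_PathT .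
  then have "\<Delta> \<turnstile> PApp (BApp (bwd R) s) r \<approx> PApp (PLam (BApp (PApp (R \<up> 1) (Var 0)) (s \<up> 1))) r \<Colon>
      subst (r \<cdot> s \<cdot> Var) A"
    using PApp_cong[OF _ r] inst_up by metis
  moreover
  have "cut (\<Delta> \<triangleright> PVar) (s \<up> 1) \<turnstile> PApp (R \<up> 1) (Var 0) \<Colon> fibre"
    using t_path_app[OF R] cut_PVar[OF \<Delta>(2)] \<Delta>(3) by simp
  then have "\<Delta> \<triangleright> PVar \<turnstile> BApp (PApp (R \<up> 1) (Var 0)) (s \<up> 1) \<Colon> subst (up (s \<cdot> Var)) A"
    using t_BApp[OF ok_path[OF \<Delta>(1)] bdim_wkn1[OF \<Delta>(2)]] inst3 by metis
  from e_Path_beta[OF this r]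
  have "\<Delta> \<turnstile> PApp (PLam (BApp (PApp (R \<up> 1) (Var 0)) (s \<up> 1))) r \<approx> BApp (PApp R r) s \<Colon> subst (r \<cdot> s \<cdot> Var) A"
    unfolding inst2 inst_up .
  ultimately show ?thesis
    by (rule e_trans)
qed

lemma wkn_fwd: "fwd Q \<up> n = fwd (Q \<up> n)" and wkn_bwd: "bwd R \<up> n = bwd (R \<up> n)"
  by (simp_all add: wkn_eq_subst subst_fwd subst_bwd)

lemma bwd_fwd:
  assumes Q: "\<Gamma> \<turnstile> Q \<Colon> BridgePathT A M0 M1 P0 P1"
  shows "\<Gamma> \<turnstile> bwd (fwd Q) \<approx> Q \<Colon> BridgePathT A M0 M1 P0 P1"
proof -
  note Q' = t_bwd[OF t_fwd[OF Q]]
  \<comment> \<open>This context is the cut of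
    \<open>\<Gamma> \<triangleright> BVar \<triangleright> PVar\<close> at its bridge variable, as
    \<open>bwd_beta\<close> and \<open>fwd_beta\<close> demand. Extensionality in both dimensions
    reduces the claim to these two rules.\<close>
  interpret w: bridge_square "\<Gamma> \<triangleright> Blank \<triangleright> PVar" "subst (up (up (shift 2))) A" "subst (up (shift 2)) M0"
    "subst (up (shift 2)) M1" "P0 \<up> 2" "P1 \<up> 2"
    using wkn[of "[PVar, Blank]"] by (simp add: numeral_2_eq_2)
  have Q2: "\<Gamma> \<triangleright> Blank \<triangleright> PVar \<turnstile> Q \<up> 2 \<Colon> BridgePathT A M0 M1 P0 P1 \<up> 2"
    using t_wkn[OF Q, of "[PVar, Blank]"] by (simp add: numeral_2_eq_2)
  note Q2 = Q2[unfolded wkn_BridgePathT]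
  have type: "subst (Var 0 \<cdot> Var 1 \<cdot> Var) (subst (up (up (shift 2))) A) = A"
    by (auto simp: sub_simps split: nat.split intro!: sub_intros)
  have "\<Gamma> \<triangleright> BVar \<triangleright> PVar \<turnstile> PApp (BApp (bwd (fwd (Q \<up> 2))) (Var 1)) (Var 0) \<approx>
      PApp (BApp (Q \<up> 2) (Var 1)) (Var 0) \<Colon> A"
    using e_trans[OF w.bwd_beta[OF _ _ _ _ w.t_fwd[OF Q2]] w.fwd_beta[OF _ _ _ _ _ Q2],
        of "\<Gamma> \<triangleright> BVar \<triangleright> PVar" "Var 1" "Var 0"] by (simp add: type[simplified])
  then have "\<Gamma> \<triangleright> BVar \<turnstile> BApp (bwd (fwd Q) \<up> 1) (Var 0) \<approx> BApp (Q \<up> 1) (Var 0) \<Colon> PathT A M0 M1"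
    by (intro Path_ext[OF t_bridge_app[OF Q'] t_bridge_app[OF Q]])
      (simp add: wkn_BApp wkn_fwd wkn_bwd)
  from Bridge_ext[OF Q'[unfolded BridgePathT_def] Q[unfolded BridgePathT_def] this] show ?thesis
    unfolding BridgePathT_def .
qed

lemma fwd_bwd:
  assumes R: "\<Gamma> \<turnstile> R \<Colon> PathBridgeT A M0 M1 P0 P1"
  shows "\<Gamma> \<turnstile> fwd (bwd R) \<approx> R \<Colon> PathBridgeT A M0 M1 P0 P1"
proof -
  note R' = t_fwd[OF t_bwd[OF R]]
  \<comment> \<open>The same argument with the dimensions in the other order: the cut of
    \<open>\<Gamma> \<triangleright> PVar \<triangleright> BVar\<close> at its bridge
    variable.\<close>
  interpret w: bridge_square "\<Gamma> \<triangleright> PVar \<triangleright> Blank" "subst (up (up (shift 2))) A" "subst (up (shift 2)) M0"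
    "subst (up (shift 2)) M1" "P0 \<up> 2" "P1 \<up> 2"
    using wkn[of "[Blank, PVar]"] by (simp add: numeral_2_eq_2)
  have R2: "\<Gamma> \<triangleright> PVar \<triangleright> Blank \<turnstile> R \<up> 2 \<Colon> PathBridgeT A M0 M1 P0 P1 \<up> 2"
    using t_wkn[OF R, of "[Blank, PVar]"] by (simp add: numeral_2_eq_2)
  note R2 = R2[unfolded wkn_PathBridgeT]
  have type: "subst (Var 1 \<cdot> Var 0 \<cdot> Var) (subst (up (up (shift 2))) A) = swap01 A"
    by (auto simp: sub_simps split: nat.split intro!: sub_intros)
  have "\<Gamma> \<triangleright> PVar \<triangleright> BVar \<turnstile> BApp (PApp (fwd (bwd (R \<up> 2))) (Var 1)) (Var 0) \<approx>
      BApp (PApp (R \<up> 2) (Var 1)) (Var 0) \<Colon> swap01 A"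
    using e_trans[OF w.fwd_beta[OF _ _ _ _ _ w.t_bwd[OF R2]] w.bwd_beta[OF _ _ _ _ R2],
        of "\<Gamma> \<triangleright> PVar \<triangleright> BVar" "Var 0" "Var 1"] by (simp add: type[simplified])
  then have "\<Gamma> \<triangleright> PVar \<turnstile> PApp (fwd (bwd R) \<up> 1) (Var 0) \<approx> PApp (R \<up> 1) (Var 0) \<Colon> fibre"
    by (intro Bridge_ext[OF t_path_app[OF R'] t_path_app[OF R]])
      (simp add: wkn_fwd wkn_bwd)
  from Path_ext[OF R'[unfolded PathBridgeT_def] R[unfolded PathBridgeT_def] this] show ?thesis
    unfolding PathBridgeT_def .
qed

end

section \<open>Assembling the equivalence\<close>

text \<open>In a round trip each map is applied under a variable of either type, hence the arbitrary
  entry \<open>e\<close>: the weakening of \<open>F\<close> under its binder and the instantiation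
  at \<open>a\<close> fuse into one substitution.\<close>

lemma Pi_beta_wkn1:
  assumes F: "\<Gamma> \<triangleright> Hyp A \<turnstile> F \<Colon> B \<up> 1" and e: "ok (\<Gamma> \<triangleright> e)" and a: "\<Gamma> \<triangleright> e \<turnstile> a \<Colon> A \<up> 1"
  shows "\<Gamma> \<triangleright> e \<turnstile> App (Lam F \<up> 1) a \<approx> subst (a \<cdot> shift 1) F \<Colon> B \<up> 1"
proof -
  have "\<Gamma> \<triangleright> e \<triangleright> Hyp (A \<up> 1) \<turnstile> subst (up (shift 1)) F \<Colon> subst (up (shift 1)) (B \<up> 1)"
    using t_sub[OF F substn_up_Hyp[OF typing_ok[OF F], of "[e]"]] e by (simp add: One_nat_def)
  note e_Pi_beta[OF this a]
  moreover have "(subst (up (shift 1)) F)\<langle>a\<rangle> = subst (a \<cdot> shift 1) F"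
    "(subst (up (shift 1)) (B \<up> 1))\<langle>a\<rangle> = B \<up> 1"
    by (auto simp: sub_simps split: nat.split intro!: sub_intros)
  ultimately show ?thesis
    by (simp add: wkn_eq_subst)
qed

theorem theorem6p2:
  fixes \<Gamma> :: ctx and A M\<^sub>0 M\<^sub>1 P\<^sub>0 P\<^sub>1 :: tm
  assumes "\<Gamma> \<triangleright> BVar \<triangleright> PVar \<turnstile> A \<Colon> Ty"
    and "\<Gamma> \<triangleright> BVar \<turnstile> M\<^sub>0 \<Colon> A\<langle>PZero\<rangle>"
    and "\<Gamma> \<triangleright> BVar \<turnstile> M\<^sub>1 \<Colon> A\<langle>POne\<rangle>"
    and "\<Gamma> \<turnstile> P\<^sub>0 \<Colon> (PathT A M\<^sub>0 M\<^sub>1)\<langle>BZero\<rangle>"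
    and "\<Gamma> \<turnstile> P\<^sub>1 \<Colon> (PathT A M\<^sub>0 M\<^sub>1)\<langle>BOne\<rangle>"
  shows "\<exists>E. \<Gamma> \<turnstile> E \<Colon> Equiv
    (BridgeT (PathT A M\<^sub>0 M\<^sub>1) P\<^sub>0 P\<^sub>1)
    (PathT (BridgeT (swap01 A) (PApp (P\<^sub>0 \<up> 1) (Var 0)) (PApp (P\<^sub>1 \<up> 1) (Var 0))) (BLam M\<^sub>0) (BLam M\<^sub>1))"
proof -
  interpret bridge_square \<Gamma> A M\<^sub>0 M\<^sub>1 P\<^sub>0 P\<^sub>1
    using assms by unfold_locales
  let ?X = "BridgePathT A M\<^sub>0 M\<^sub>1 P\<^sub>0 P\<^sub>1" and ?Y = "PathBridgeT A M\<^sub>0 M\<^sub>1 P\<^sub>0 P\<^sub>1"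
  let ?f = "Lam (fwd (Var 0))" and ?g = "Lam (bwd (Var 0))"
  have okX: "ok (\<Gamma> \<triangleright> Hyp ?X)" and okY: "ok (\<Gamma> \<triangleright> Hyp ?Y)"
    by (rule ok_HypI[OF t_BridgePathT] ok_HypI[OF t_PathBridgeT])+
  \<comment> \<open>The body of \<open>?f\<close> lives under a variable of type \<open>?X\<close>;
    over the square weakened by it, \<open>Var 0\<close> is an element to which \<open>t_fwd\<close>
    and \<open>bwd_fwd\<close> apply.\<close>
  interpret X: bridge_square "\<Gamma> \<triangleright> Hyp ?X" "subst (up (up (shift 1))) A" "subst (up (shift 1)) M\<^sub>0"
    "subst (up (shift 1)) M\<^sub>1" "P\<^sub>0 \<up> 1" "P\<^sub>1 \<up> 1"
    using wkn[of "[Hyp ?X]"] okX by (simp add: One_nat_def)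
  interpret Y: bridge_square "\<Gamma> \<triangleright> Hyp ?Y" "subst (up (up (shift 1))) A" "subst (up (shift 1)) M\<^sub>0"
    "subst (up (shift 1)) M\<^sub>1" "P\<^sub>0 \<up> 1" "P\<^sub>1 \<up> 1"
    using wkn[of "[Hyp ?Y]"] okY by (simp add: One_nat_def)
  note x = t_Var0[OF okX] and y = t_Var0[OF okY]
  have F: "\<Gamma> \<triangleright> Hyp ?X \<turnstile> fwd (Var 0) \<Colon> ?Y \<up> 1"
    using X.t_fwd x unfolding wkn_BridgePathT wkn_PathBridgeT by blast
  have G: "\<Gamma> \<triangleright> Hyp ?Y \<turnstile> bwd (Var 0) \<Colon> ?X \<up> 1"
    using Y.t_bwd y unfolding wkn_BridgePathT wkn_PathBridgeT by blast
  have f: "\<Gamma> \<turnstile> ?f \<Colon> Fn ?X ?Y" and g: "\<Gamma> \<turnstile> ?g \<Colon> Fn ?Y ?X"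
    unfolding Fn_def by (intro t_Lam F G)+
  note fX = t_wkn1[OF f okX, unfolded wkn_Fn] and gX = t_wkn1[OF g okX, unfolded wkn_Fn]
    and fY = t_wkn1[OF f okY, unfolded wkn_Fn] and gY = t_wkn1[OF g okY, unfolded wkn_Fn]
  \<comment> \<open>The inner redex is reduced first, under the weakened \<open>?g\<close>; then the
    outer redex is reduced and the inverse law of the weakened square applies.\<close>
  have "\<Gamma> \<triangleright> Hyp ?X \<turnstile> App (?f \<up> 1) (Var 0) \<approx> fwd (Var 0) \<Colon> ?Y \<up> 1"
    using Pi_beta_wkn1[OF F okX x] by (simp add: subst_fwd scons_def)
  from e_fapp[OF gX this]
  have "\<Gamma> \<triangleright> Hyp ?X \<turnstile> App (?g \<up> 1) (App (?f \<up> 1) (Var 0)) \<approx> App (?g \<up> 1) (fwd (Var 0)) \<Colon> ?X \<up> 1" .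
  also have "\<Gamma> \<triangleright> Hyp ?X \<turnstile> App (?g \<up> 1) (fwd (Var 0)) \<approx> bwd (fwd (Var 0)) \<Colon> ?X \<up> 1"
    using Pi_beta_wkn1[OF G okX F] by (simp add: subst_bwd scons_def)
  also (e_trans) have "\<Gamma> \<triangleright> Hyp ?X \<turnstile> bwd (fwd (Var 0)) \<approx> Var 0 \<Colon> ?X \<up> 1"
    using X.bwd_fwd x unfolding wkn_BridgePathT by blast
  finally (e_trans) have gf: "\<Gamma> \<triangleright> Hyp ?X \<turnstile> App (?g \<up> 1) (App (?f \<up> 1) (Var 0)) \<approx> Var 0 \<Colon> ?X \<up> 1" .
  have "\<Gamma> \<triangleright> Hyp ?Y \<turnstile> App (?g \<up> 1) (Var 0) \<approx> bwd (Var 0) \<Colon> ?X \<up> 1"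
    using Pi_beta_wkn1[OF G okY y] by (simp add: subst_bwd scons_def)
  from e_fapp[OF fY this]
  have "\<Gamma> \<triangleright> Hyp ?Y \<turnstile> App (?f \<up> 1) (App (?g \<up> 1) (Var 0)) \<approx> App (?f \<up> 1) (bwd (Var 0)) \<Colon> ?Y \<up> 1" .
  also have "\<Gamma> \<triangleright> Hyp ?Y \<turnstile> App (?f \<up> 1) (bwd (Var 0)) \<approx> fwd (bwd (Var 0)) \<Colon> ?Y \<up> 1"
    using Pi_beta_wkn1[OF F okY G] by (simp add: subst_fwd scons_def)
  also (e_trans) have "\<Gamma> \<triangleright> Hyp ?Y \<turnstile> fwd (bwd (Var 0)) \<approx> Var 0 \<Colon> ?Y \<up> 1"
    using Y.fwd_bwd y unfolding wkn_PathBridgeT by blast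
  finally (e_trans) have fg: "\<Gamma> \<triangleright> Hyp ?Y \<turnstile> App (?f \<up> 1) (App (?g \<up> 1) (Var 0)) \<approx> Var 0 \<Colon> ?Y \<up> 1" .
  show ?thesis
    using Equiv_of_judgmental_iso[OF t_BridgePathT t_PathBridgeT f g gf fg] unfolding BridgePathT_def PathBridgeT_def .
qed

end
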